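(* Let $\boldsymbol\mu=(\mu_1,\dots,\mu_k)$ be a sequence of valuated matroids on $[n]$, of ranks $r_1\le\cdots\le r_k$, whose sequence of underlying matroids $\boldsymbol M=(M_1,\dots,M_k)$ is a flag matroid. Then the following are equivalent: (a) the image $(\overline{\mu_1},\dots,\overline{\mu_k})\in\prod_{i=1}^k\mathbb P(\mathbb T^{\binom{[n]}{r_i}})$ lies in the flag Dressian $FlDr(\boldsymbol M)$, i.e. it satisfies the tropical Grassmann–Plücker and tropical incidence–Plücker relations; (b) $\boldsymbol\mu$ is a valuated flag matroid (with underlying flag matroid $\boldsymbol M$); (c) the weight $w(B_1,\dots,B_k):=\sum_{i=1}^k\mu_i(B_i)$ on $\mathcal B(M_1)\times\cdots\times\mathcal B(M_k)$ induces a subdivision of the base configuration of $\boldsymbol M$ into base configurations of flag matroids; that is, for every $u\in\mathbb R^n$ the set of tuples $(B_1,\dots,B_k)\in\mathcal B(M_1)\times\cdots\times\mathcal B(M_k)$ minimizing $\sum_{i=1}^k\big(\mu_i(B_i)+\langle u,\mathbf e_{B_i}\rangle\big)$ equals $\mathcal B(N_1)\times\cdots\times\mathcal B(N_k)$ for some flag matroid $(N_1,\dots,N_k)$ on $[n]$; (d) the projective tropical linear spaces form a flag $\overline{\operatorname{trop}}(\mu_1)\subseteq\overline{\operatorname{trop}}(\mu_2)\subseteq\cdots\subseteq\overline{\operatorname{trop}}(\mu_k)$ in $\mathbb P(\mathbb T^{[n]})$.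
   Context: Tropical conventions: $\mathbb T=\mathbb R\cup\{\infty\}$ with $a\odot b=a+b$, $a\oplus b=\min(a,b)$. For a finite set $E$, $\mathbb P(\mathbb T^E)=(\mathbb T^E\setminus\{(\infty,\dots,\infty)\})/\sim$ where $u\sim u+c\mathbf 1$ for $c\in\mathbb R$; $\bar u$ denotes the class of $u$. For nonempty $S\subseteq E$, $T_S\subseteq\mathbb P(\mathbb T^E)$ is the set of classes of vectors whose finite coordinates are exactly those indexed by $S$; it is identified with $\mathbb R^S/\mathbb R\mathbf 1$. For a finite list of elements of $\mathbb T$, "the minimum is attained at least twice" is declared to hold also when all entries are $\infty$. $\mathbf e_B=\sum_{i\in B}\mathbf e_i$. Valuated matroids: a valuated matroid of rank $r$ on a finite set $E$ is a function $\mu:\binom{E}{r}\to\mathbb T$ such that $\mathcal B(M):=\{I:\mu(I)\neq\infty\}$ is the set of bases of a matroid $M$ on $E$ (the underlying matroid), and for all $B,B'\in\mathcal B(M)$ and $i\in B\setminus B'$ there is $j\in B'\setminus B$ with $\mu(B)+\mu(B')\ge\mu(B\setminus i\cup j)+\mu(B'\setminus j\cup i)$. For $S\subseteq E$, let $\mathcal B_S$ be the set of bases $B$ of $M$ with $|B\cap S|$ maximal; the contraction $\mu/_S$ is the function on $\binom{E\setminus S}{r-\operatorname{rk}_M(S)}$ (finite exactly on bases of $M/_S$), and the restriction $\mu|_S$ the function on $\binom{S}{\operatorname{rk}_M(S)}$ (finite exactly on bases of $M|_S$), determined up to additive constants by $\mu(B)=\mu|_S(B\cap S)+\mu/_S(B\setminus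 S)$ for all $B\in\mathcal B_S$; both are valuated matroids. The valuated circuits of $\mu$ are the vectors $\mathbf C_\mu(S)\in\mathbb T^E$, $S\in\binom{E}{r+1}$, with $C_\mu(S)_i=\mu(S\setminus i)$ if $i\in S$ and $\infty$ otherwise, excluding the all-$\infty$ vector. The tropical linear space $\operatorname{trop}(\mu)\subseteq\mathbb R^E/\mathbb R\mathbf 1$ is the set of $\bar u$ such that for every valuated circuit $\mathbf C$ the minimum of $\{C_i+u_i: C_i\neq\infty\}$ is attained at least twice. The projective tropical linear space of $\mu$ on $[n]$ is $\overline{\operatorname{trop}}(\mu)=\bigcup_{\emptyset\subseteq S\subsetneq[n]}\operatorname{trop}(\mu/_S)\times\{\infty\}^S\subseteq\mathbb P(\mathbb T^{[n]})$, with $\operatorname{trop}(\mu/_S)$ regarded as a subset of $T_{[n]\setminus S}$. Flag matroids: for matroids $M,N$ on $[n]$, $M\twoheadleftarrow N$ (matroid quotient) means every circuit of $N$ is a union of circuits of $M$; $(M_1,\dots,M_k)$ is a flag matroid if $M_i\twoheadleftarrow M_j$ for all $i<j$. Valuated flag matroids: for valuated matroids $\mu,\nu$ on $[n]$ of ranks $r\le s$ with underlying matroids $M,N$, $\mu\twoheadleftarrow\nu$ means: for all $I\in\mathcal B(M)$, $J\in\mathcal B(N)$, $i\in I\setminus J$ there is $j\in J\setminus I$ with $\mu(I)+\nu(J)\ge\mu(I\setminus i\cup j)+\nu(J\setminus j\cup i)$; $(\mu_1,\dots,\mu_k)$ is a valuated flag matroid if $\mu_i\twoheadleftarrow\mu_j$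 for all $i<j$. Flag Dressian: the tropical Grassmann–Plücker relations for $p\in\mathbb T^{\binom{[n]}{r}}$ require, for all $I,J\in\binom{[n]}{r}$ with $|I\cap J|<r-1$ and $i\in I\setminus J$, that the minimum of $\{p(I)+p(J)\}\cup\{p(I\setminus i\cup j)+p(J\setminus j\cup i): j\in J\setminus I\}$ is attained at least twice. The tropical incidence–Plücker relations for $(p,q)\in\mathbb T^{\binom{[n]}{r}}\times\mathbb T^{\binom{[n]}{s}}$, $r\le s$, require, for all $I'\in\binom{[n]}{r-1}$ and $J'\in\binom{[n]}{s+1}$, that the minimum of $\{p(I'\cup j)+q(J'\setminus j): j\in J'\setminus I'\}$ is attained at least twice. $FlDr(r_1,\dots,r_k;n)\subseteq\prod_i\mathbb P(\mathbb T^{\binom{[n]}{r_i}})$ is the set of $(\overline{p_1},\dots,\overline{p_k})$ with each $p_i$ satisfying the Grassmann–Plücker relations and each pair $(p_i,p_j)$, $i<j$, satisfying the incidence–Plücker relations. For a flag matroid $\boldsymbol M$ of rank $(r_1,\dots,r_k)$, $FlDr(\boldsymbol M)$ is the set of points of $FlDr(r_1,\dots,r_k;n)$ whose $i$-th component has finite coordinates exactly at $\mathcal B(M_i)$ for each $i$. *)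

theory Defs
  imports "HOL-Library.Extended_Real" "HOL-Library.Multiset" "HOL-Library.Ramsey"
    "HOL-Library.FuncSet" "HOL-Library.Indicator_Function"
begin

text \<open>
  Tropical numbers are the extended reals other than \<open>-\<infinity>\<close>. Vectors over a finite set \<open>E\<close> are
  extensional functions, so that equality of vectors is equality in HOL. Tuples \<open>(x\<^sub>1, \<dots>, x\<^sub>k)\<close> are
  functions on \<open>{1..k}\<close>, and \<open>nsets E r\<close> is the set of \<open>r\<close>-element subsets of \<open>E\<close>.
\<close>

definition trop_vec :: "'a set \<Rightarrow> ('a \<Rightarrow> ereal) set"
  where "trop_vec E = E \<rightarrow>\<^sub>E {x. x \<noteq> -\<infinity>}"

definition infty_vec :: "'a set \<Rightarrow> 'a \<Rightarrow> ereal"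
  where "infty_vec E = (\<lambda>i\<in>E. \<infinity>)"

definition proj_rel :: "'a set \<Rightarrow> (('a \<Rightarrow> ereal) \<times> ('a \<Rightarrow> ereal)) set"
  where "proj_rel E = {(u, v). u \<in> trop_vec E - {infty_vec E} \<and> v \<in> trop_vec E - {infty_vec E} \<and>
    (\<exists>c::real. \<forall>i\<in>E. v i = u i + ereal c)}"

definition trop_proj :: "'a set \<Rightarrow> ('a \<Rightarrow> ereal) set set"
  where "trop_proj E = (trop_vec E - {infty_vec E}) // proj_rel E"

definition proj_class :: "'a set \<Rightarrow> ('a \<Rightarrow> ereal) \<Rightarrow> ('a \<Rightarrow> ereal) set"
  where "proj_class E u = proj_rel E `` {u}"

definition trop_stratum :: "'a set \<Rightarrow> 'a set \<Rightarrow> ('a \<Rightarrow> ereal) set set"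
  where "trop_stratum E S = {proj_class E u | u. u \<in> trop_vec E - {infty_vec E} \<and> {i\<in>E. u i \<noteq> \<infinity>} = S}"

definition min_attained_twice :: "ereal multiset \<Rightarrow> bool"
  where "min_attained_twice A \<longleftrightarrow> (\<forall>x\<in>#A. x = \<infinity>) \<or> count A (Min (set_mset A)) \<ge> 2"

text \<open>A matroid on \<open>E\<close> is represented by its set of bases.\<close>

definition matroid :: "'a set \<Rightarrow> 'a set set \<Rightarrow> bool"
  where "matroid E \<B> \<longleftrightarrow> finite E \<and> \<B> \<subseteq> Pow E \<and> \<B> \<noteq> {} \<and>
    (\<forall>B\<in>\<B>. \<forall>B'\<in>\<B>. \<forall>i\<in>B - B'. \<exists>j\<in>B' - B. insert j (B - {i}) \<in> \<B>)"

definition indep :: "'a set set \<Rightarrow> 'a set \<Rightarrow> bool"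
  where "indep \<B> X \<longleftrightarrow> (\<exists>B\<in>\<B>. X \<subseteq> B)"

definition circuits :: "'a set \<Rightarrow> 'a set set \<Rightarrow> 'a set set"
  where "circuits E \<B> = {C. C \<subseteq> E \<and> \<not> indep \<B> C \<and> (\<forall>X. X \<subset> C \<longrightarrow> indep \<B> X)}"

definition matroid_rank :: "'a set set \<Rightarrow> 'a set \<Rightarrow> nat"
  where "matroid_rank \<B> S = Max ((\<lambda>B. card (B \<inter> S)) ` \<B>)"

definition max_meeting_bases :: "'a set set \<Rightarrow> 'a set \<Rightarrow> 'a set set"
  where "max_meeting_bases \<B> S = {B\<in>\<B>. \<forall>B'\<in>\<B>. card (B' \<inter> S) \<le> card (B \<inter> S)}"

definition restriction_bases :: "'a set set \<Rightarrow> 'a set \<Rightarrow> 'a set set"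
  where "restriction_bases \<B> S = (\<lambda>B. B \<inter> S) ` max_meeting_bases \<B> S"

definition contraction_bases :: "'a set set \<Rightarrow> 'a set \<Rightarrow> 'a set set"
  where "contraction_bases \<B> S = (\<lambda>B. B - S) ` max_meeting_bases \<B> S"

definition matroid_quotient :: "'a set \<Rightarrow> 'a set set \<Rightarrow> 'a set set \<Rightarrow> bool"
  where "matroid_quotient E M N \<longleftrightarrow> (\<forall>C\<in>circuits E N. \<exists>\<D>\<subseteq>circuits E M. C = \<Union>\<D>)"

definition flag_matroid :: "'a set \<Rightarrow> nat \<Rightarrow> (nat \<Rightarrow> 'a set set) \<Rightarrow> bool"
  where "flag_matroid E k M \<longleftrightarrow> (\<forall>i\<in>{1..k}. matroid E (M i)) \<and>
    (\<forall>i\<in>{1..k}. \<forall>j\<in>{1..k}. i < j \<longrightarrow> matroid_quotient E (M i) (M j))"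

definition val_bases :: "'a set \<Rightarrow> nat \<Rightarrow> ('a set \<Rightarrow> ereal) \<Rightarrow> 'a set set"
  where "val_bases E r \<mu> = {I \<in> nsets E r. \<mu> I \<noteq> \<infinity>}"

definition valuated_matroid :: "'a set \<Rightarrow> nat \<Rightarrow> ('a set \<Rightarrow> ereal) \<Rightarrow> bool"
  where "valuated_matroid E r \<mu> \<longleftrightarrow> \<mu> \<in> trop_vec (nsets E r) \<and> matroid E (val_bases E r \<mu>) \<and>
    (\<forall>B\<in>val_bases E r \<mu>. \<forall>B'\<in>val_bases E r \<mu>. \<forall>i\<in>B - B'. \<exists>j\<in>B' - B.
      \<mu> B + \<mu> B' \<ge> \<mu> (insert j (B - {i})) + \<mu> (insert i (B' - {j})))"

text \<open>
  \<open>\<rho>\<close> and \<open>\<kappa>\<close> are a restriction to \<open>S\<close> and a contraction by \<open>S\<close>. Such a pair is unique only up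
  to additive constants, which do not affect the tropical linear space of the contraction.
\<close>

definition is_restriction_contraction ::
  "'a set \<Rightarrow> nat \<Rightarrow> ('a set \<Rightarrow> ereal) \<Rightarrow> 'a set \<Rightarrow> ('a set \<Rightarrow> ereal) \<Rightarrow> ('a set \<Rightarrow> ereal) \<Rightarrow> bool"
  where "is_restriction_contraction E r \<mu> S \<rho> \<kappa> \<longleftrightarrow>
    (let \<B> = val_bases E r \<mu>; s = matroid_rank \<B> S in
      \<rho> \<in> trop_vec (nsets S s) \<and> val_bases S s \<rho> = restriction_bases \<B> S \<and>
      \<kappa> \<in> trop_vec (nsets (E - S) (r - s)) \<and> val_bases (E - S) (r - s) \<kappa> = contraction_bases \<B> S \<and>
      (\<forall>B\<in>max_meeting_bases \<B> S. \<mu> B = \<rho> (B \<inter> S) + \<kappa> (B - S)))"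

definition val_contraction :: "'a set \<Rightarrow> nat \<Rightarrow> ('a set \<Rightarrow> ereal) \<Rightarrow> 'a set \<Rightarrow> 'a set \<Rightarrow> ereal"
  where "val_contraction E r \<mu> S = (SOME \<kappa>. \<exists>\<rho>. is_restriction_contraction E r \<mu> S \<rho> \<kappa>)"

definition valuated_circuit :: "'a set \<Rightarrow> ('a set \<Rightarrow> ereal) \<Rightarrow> 'a set \<Rightarrow> 'a \<Rightarrow> ereal"
  where "valuated_circuit E \<mu> S = (\<lambda>i\<in>E. if i \<in> S then \<mu> (S - {i}) else \<infinity>)"

definition valuated_circuits :: "'a set \<Rightarrow> nat \<Rightarrow> ('a set \<Rightarrow> ereal) \<Rightarrow> ('a \<Rightarrow> ereal) set"
  where "valuated_circuits E r \<mu> = valuated_circuit E \<mu> ` nsets E (r + 1) - {infty_vec E}"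

text \<open>The torus \<open>\<real>\<^sup>E / \<real>\<one>\<close> is identified with the stratum \<open>trop_stratum E E\<close>.\<close>

definition trop_linear_space :: "'a set \<Rightarrow> nat \<Rightarrow> ('a set \<Rightarrow> ereal) \<Rightarrow> ('a \<Rightarrow> ereal) set set"
  where "trop_linear_space E r \<mu> = {proj_class E u | u. u \<in> E \<rightarrow>\<^sub>E range ereal \<and>
    (\<forall>C\<in>valuated_circuits E r \<mu>.
      min_attained_twice {# C i + u i. i \<in># mset_set {i\<in>E. C i \<noteq> \<infinity>} #})}"

text \<open>\<open>times_infty E S X\<close> is \<open>X \<times> {\<infinity>}\<^sup>S\<close> for a set \<open>X\<close> of classes of vectors over \<open>E - S\<close>.\<close>

definition times_infty :: "'a set \<Rightarrow> 'a set \<Rightarrow> ('a \<Rightarrow> ereal) set set \<Rightarrow> ('a \<Rightarrow> ereal) set set"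
  where "times_infty E S X = {proj_class E (\<lambda>i\<in>E. if i \<in> S then \<infinity> else u i) | u.
    u \<in> trop_vec (E - S) \<and> proj_class (E - S) u \<in> X}"

definition proj_trop_linear_space :: "'a set \<Rightarrow> nat \<Rightarrow> ('a set \<Rightarrow> ereal) \<Rightarrow> ('a \<Rightarrow> ereal) set set"
  where "proj_trop_linear_space E r \<mu> = (\<Union>S\<in>{S. S \<subset> E}. times_infty E S
    (trop_linear_space (E - S) (r - matroid_rank (val_bases E r \<mu>) S) (val_contraction E r \<mu> S)))"

definition valuated_quotient ::
  "'a set \<Rightarrow> nat \<Rightarrow> ('a set \<Rightarrow> ereal) \<Rightarrow> nat \<Rightarrow> ('a set \<Rightarrow> ereal) \<Rightarrow> bool"
  where "valuated_quotient E r \<mu> s \<nu> \<longleftrightarrow>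
    (\<forall>I\<in>val_bases E r \<mu>. \<forall>J\<in>val_bases E s \<nu>. \<forall>i\<in>I - J. \<exists>j\<in>J - I.
      \<mu> I + \<nu> J \<ge> \<mu> (insert j (I - {i})) + \<nu> (insert i (J - {j})))"

definition valuated_flag_matroid ::
  "'a set \<Rightarrow> nat \<Rightarrow> (nat \<Rightarrow> nat) \<Rightarrow> (nat \<Rightarrow> 'a set \<Rightarrow> ereal) \<Rightarrow> bool"
  where "valuated_flag_matroid E k r \<mu> \<longleftrightarrow>
    (\<forall>i\<in>{1..k}. valuated_matroid E (r i) (\<mu> i)) \<and> mono_on {1..k} r \<and>
    (\<forall>i\<in>{1..k}. \<forall>j\<in>{1..k}. i < j \<longrightarrow> valuated_quotient E (r i) (\<mu> i) (r j) (\<mu> j))"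

definition grassmann_pluecker :: "'a set \<Rightarrow> nat \<Rightarrow> ('a set \<Rightarrow> ereal) \<Rightarrow> bool"
  where "grassmann_pluecker E r p \<longleftrightarrow>
    (\<forall>I\<in>nsets E r. \<forall>J\<in>nsets E r. card (I \<inter> J) + 1 < r \<longrightarrow> (\<forall>i\<in>I - J.
      min_attained_twice (add_mset (p I + p J)
        {# p (insert j (I - {i})) + p (insert i (J - {j})). j \<in># mset_set (J - I) #})))"

text \<open>The condition \<open>card I' + 1 = r\<close> leaves no \<open>I'\<close>, hence no relation, when \<open>r = 0\<close>.\<close>

definition incidence_pluecker ::
  "'a set \<Rightarrow> nat \<Rightarrow> ('a set \<Rightarrow> ereal) \<Rightarrow> nat \<Rightarrow> ('a set \<Rightarrow> ereal) \<Rightarrow> bool"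
  where "incidence_pluecker E r p s q \<longleftrightarrow>
    (\<forall>I'\<subseteq>E. \<forall>J'\<in>nsets E (s + 1). card I' + 1 = r \<longrightarrow>
      min_attained_twice {# p (insert j I') + q (J' - {j}). j \<in># mset_set (J' - I') #})"

definition flag_dressian ::
  "'a set \<Rightarrow> nat \<Rightarrow> (nat \<Rightarrow> nat) \<Rightarrow> (nat \<Rightarrow> ('a set \<Rightarrow> ereal) set) set"
  where "flag_dressian E k r = {P \<in> (\<Pi>\<^sub>E i\<in>{1..k}. trop_proj (nsets E (r i))). \<exists>p.
    (\<forall>i\<in>{1..k}. p i \<in> P i) \<and>
    (\<forall>i\<in>{1..k}. grassmann_pluecker E (r i) (p i)) \<and>
    (\<forall>i\<in>{1..k}. \<forall>j\<in>{1..k}. i < j \<longrightarrow> incidence_pluecker E (r i) (p i) (r j) (p j))}"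

definition flag_dressian_of ::
  "'a set \<Rightarrow> nat \<Rightarrow> (nat \<Rightarrow> nat) \<Rightarrow> (nat \<Rightarrow> 'a set set) \<Rightarrow> (nat \<Rightarrow> ('a set \<Rightarrow> ereal) set) set"
  where "flag_dressian_of E k r M =
    {P \<in> flag_dressian E k r. \<forall>i\<in>{1..k}. P i \<in> trop_stratum (nsets E (r i)) (M i)}"

definition flag_weight ::
  "'a set \<Rightarrow> nat \<Rightarrow> (nat \<Rightarrow> 'a set \<Rightarrow> ereal) \<Rightarrow> ('a \<Rightarrow> real) \<Rightarrow> (nat \<Rightarrow> 'a set) \<Rightarrow> ereal"
  where "flag_weight E k \<mu> u B =
    (\<Sum>i=1..k. \<mu> i (B i) + ereal (\<Sum>a\<in>E. u a * indicator (B i) a))"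

definition flag_minimizers ::
  "'a set \<Rightarrow> nat \<Rightarrow> (nat \<Rightarrow> 'a set set) \<Rightarrow> (nat \<Rightarrow> 'a set \<Rightarrow> ereal) \<Rightarrow> ('a \<Rightarrow> real) \<Rightarrow> (nat \<Rightarrow> 'a set) set"
  where "flag_minimizers E k M \<mu> u =
    {B \<in> Pi\<^sub>E {1..k} M. \<forall>B'\<in>Pi\<^sub>E {1..k} M. flag_weight E k \<mu> u B \<le> flag_weight E k \<mu> u B'}"

end

theory Submission
  imports Defs
begin

text \<open>
  All four conditions are compared through the set \<open>L(\<mu>)\<close> of tropical vectors \<open>u\<close>, infinite
  coordinates allowed, such that for every \<open>(r+1)\<close>-set \<open>S\<close> the minimum of the \<open>\<mu>(S \<setminus> i) + u\<^sub>i\<close> is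
  attained twice; its projectivization is the projective tropical linear space. The incidence
  relations for \<open>(\<mu>, \<nu>)\<close> say that the cocircuit vectors \<open>j \<mapsto> \<mu>(I \<union> j)\<close> of \<open>\<mu>\<close> lie in \<open>L(\<nu>)\<close>,
  and they are the exchange axiom of a valuated quotient read with \<open>I = I' \<union> i\<close>, \<open>J = J' \<setminus> i\<close>.

  (b) implies (c): exchange is inherited by the bases minimizing \<open>\<mu> + w\<close> and \<open>\<nu> + w\<close>, and a pair of
  basis families with symmetric exchange is a matroid quotient.
  (c) implies (d): if \<open>u \<in> L(\<mu>)\<close> then, for any real \<open>w\<close> equal to \<open>-u\<close> on the support of \<open>u\<close>, every
  element of the support lies in a basis minimizing \<open>\<mu> + w\<close>. Non-loops stay non-loops under
  \<open>\<twoheadleftarrow>\<close>, so the same holds for \<open>\<nu>\<close>; letting \<open>w\<close> be very negative off the support, the resulting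
  bases exhibit \<open>u\<close> as a tropical combination of cocircuit vectors of \<open>\<nu>\<close>, whence \<open>u \<in> L(\<nu>)\<close>.
  (d) implies (b): the cocircuit vectors of \<open>\<mu>\<close> lie in \<open>L(\<mu>)\<close>, hence in \<open>L(\<nu>)\<close>.
\<close>

section \<open>Minima attained twice, and exchange between bases\<close>

text \<open>Replaces multisets and \<open>Min\<close> by a local condition: every finite entry has a
  rival index that is at most as large. At a minimizer the rival must tie, which gives the second
  occurrence. Conversely, two minimizers always leave one that differs from a given index. Infinite
  entries demand nothing, which matches the all-infinite convention.\<close>

lemma min_attained_twice_image_iff:
  assumes "finite A"
  shows "min_attained_twice {# f i. i \<in># mset_set A #} \<longleftrightarrow>
    (\<forall>i\<in>A. f i \<noteq> \<infinity> \<longrightarrow> (\<exists>j\<in>A. j \<noteq> i \<and> f j \<le> f i))"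
proof -
  define m where "m = Min (f ` A)"
  have cnt: "count {# f i. i \<in># mset_set A #} m = card {j\<in>A. f j = m}"
  proof -
    have "f -` {m} \<inter> A = {j\<in>A. f j = m}"
      by auto
    then show ?thesis
      using assms by (simp add: count_image_mset)
  qed
  have m_le: "m \<le> f i" if "i \<in> A" for i
    using that assms by (simp add: m_def)
  show ?thesis
  proof
    assume L: "min_attained_twice {# f i. i \<in># mset_set A #}"
    show "\<forall>i\<in>A. f i \<noteq> \<infinity> \<longrightarrow> (\<exists>j\<in>A. j \<noteq> i \<and> f j \<le> f i)"
    proof (intro ballI impI)
      fix i assume i: "i \<in> A" "f i \<noteq> \<infinity>"
      then have "2 \<le> card {j\<in>A. f j = m}"
        using L assms cnt by (auto simp: min_attained_twice_def m_def)
      then have "\<not> {j\<in>A. f j = m} \<subseteq> {i}"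
        using card_mono[of "{i}" "{j\<in>A. f j = m}"] by auto
      then show "\<exists>j\<in>A. j \<noteq> i \<and> f j \<le> f i"
        using m_le[OF i(1)] by auto
    qed
  next
    assume R: "\<forall>i\<in>A. f i \<noteq> \<infinity> \<longrightarrow> (\<exists>j\<in>A. j \<noteq> i \<and> f j \<le> f i)"
    show "min_attained_twice {# f i. i \<in># mset_set A #}"
    proof (cases "\<forall>i\<in>A. f i = \<infinity>")
      case True
      then show ?thesis
        using assms by (auto simp: min_attained_twice_def)
    next
      case False
      then obtain a where a: "a \<in> A" "f a \<noteq> \<infinity>"
        by blast
      have "m \<in> f ` A"
        unfolding m_def using a assms by (intro Min_in) auto
      then obtain i where i: "i \<in> A" "f i = m"
        by blast
      with a m_le[OF a(1)] have "f i \<noteq> \<infinity>"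
        by auto
      then obtain j where j: "j \<in> A" "j \<noteq> i" "f j \<le> f i"
        using R i by blast
      then have "{i, j} \<subseteq> {j\<in>A. f j = m}"
        using i m_le[OF j(1)] by auto
      then have "card {i, j} \<le> card {j\<in>A. f j = m}"
        using assms by (intro card_mono) auto
      then show ?thesis
        using j assms cnt by (simp add: min_attained_twice_def m_def)
    qed
  qed
qed

lemma val_basesD:
  assumes "B \<in> val_bases E r \<mu>"
  shows "B \<subseteq> E" "finite B" "card B = r" "\<mu> B \<noteq> \<infinity>"
  using assms by (auto simp: val_bases_def nsets_def)

lemma trop_vec_not_MInf: "u \<in> trop_vec E \<Longrightarrow> i \<in> E \<Longrightarrow> u i \<noteq> -\<infinity>"
  by (auto simp: trop_vec_def)

lemma val_bases_real:
  assumes "\<mu> \<in> trop_vec (nsets E r)" "B \<in> val_bases E r \<mu>"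
  obtains x where "\<mu> B = ereal x"
  using assms trop_vec_not_MInf[of \<mu> "nsets E r" B] by (cases "\<mu> B") (auto simp: val_bases_def)

lemma nsets_exchange:
  assumes "I \<in> nsets E r" "i \<in> I" "j \<in> E" "j \<notin> I - {i}"
  shows "insert j (I - {i}) \<in> nsets E r"
proof -
  have "card (insert j (I - {i})) = card I"
    using assms card_Suc_Diff1[of I i] by (subst card_insert_disjoint) (auto simp: nsets_def)
  then show ?thesis
    using assms by (auto simp: nsets_def)
qed

lemma nsets_insert: "J \<in> nsets E s \<Longrightarrow> i \<in> E \<Longrightarrow> i \<notin> J \<Longrightarrow> insert i J \<in> nsets E (s + 1)"
  by (auto simp: nsets_def)

lemma nsets_remove: "S \<in> nsets E (s + 1) \<Longrightarrow> i \<in> S \<Longrightarrow> S - {i} \<in> nsets E s"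
  by (auto simp: nsets_def)

lemma finite_val_bases: "finite E \<Longrightarrow> finite (val_bases E r \<mu>)"
  by (rule finite_subset[of _ "Pow E"]) (auto simp: val_bases_def nsets_def)

lemma valuated_matroid_imp_quotient: "valuated_matroid E r \<mu> \<Longrightarrow> valuated_quotient E r \<mu> r \<mu>"
  by (simp add: valuated_matroid_def valuated_quotient_def)

lemma valuated_matroidD:
  assumes "valuated_matroid E r \<mu>"
  shows "finite E" "\<mu> \<in> trop_vec (nsets E r)" "val_bases E r \<mu> \<noteq> {}"
  using assms by (auto simp: valuated_matroid_def matroid_def)

text \<open>The right-hand side of the exchange inequality is finite and no value is minus infinity,
  so both exchanged sets have finite value and the exchange stays among bases. With
  \<open>\<mu> = \<nu>\<close> this serves single valuated matroids as well.\<close>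

lemma valuated_quotient_exchange:
  assumes q: "valuated_quotient E r \<mu> s \<nu>"
    and \<mu>: "\<mu> \<in> trop_vec (nsets E r)" and \<nu>: "\<nu> \<in> trop_vec (nsets E s)"
    and I: "I \<in> val_bases E r \<mu>" and J: "J \<in> val_bases E s \<nu>" and i: "i \<in> I - J"
  obtains j where "j \<in> J - I" "insert j (I - {i}) \<in> val_bases E r \<mu>"
    "insert i (J - {j}) \<in> val_bases E s \<nu>"
    "\<mu> (insert j (I - {i})) + \<nu> (insert i (J - {j})) \<le> \<mu> I + \<nu> J"
proof -
  obtain j where j: "j \<in> J - I"
    and le: "\<mu> (insert j (I - {i})) + \<nu> (insert i (J - {j})) \<le> \<mu> I + \<nu> J"
    using q I J i unfolding valuated_quotient_def by blast
  have n: "insert j (I - {i}) \<in> nsets E r" "insert i (J - {j}) \<in> nsets E s"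
    using I J i j by (auto intro!: nsets_exchange simp: val_bases_def) (auto simp: nsets_def)
  obtain x y where "\<mu> I = ereal x" "\<nu> J = ereal y"
    using val_bases_real[OF \<mu> I] val_bases_real[OF \<nu> J] by metis
  with le have "\<mu> (insert j (I - {i})) \<noteq> \<infinity>" "\<nu> (insert i (J - {j})) \<noteq> \<infinity>"
    using trop_vec_not_MInf[OF \<mu> n(1)] trop_vec_not_MInf[OF \<nu> n(2)] by auto
  with n j le show thesis
    by (intro that) (auto simp: val_bases_def)
qed

section \<open>Incidence relations as exchange\<close>

lemma incidence_pluecker_iff:
  assumes "finite E"
  shows "incidence_pluecker E r p s q \<longleftrightarrow>
    (\<forall>I'\<subseteq>E. \<forall>J'\<in>nsets E (s + 1). card I' + 1 = r \<longrightarrow>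
      (\<forall>i\<in>J' - I'. p (insert i I') + q (J' - {i}) \<noteq> \<infinity> \<longrightarrow>
        (\<exists>j\<in>J' - I'. j \<noteq> i \<and> p (insert j I') + q (J' - {j}) \<le> p (insert i I') + q (J' - {i}))))"
proof -
  have "finite (J' - I')" if "J' \<in> nsets E (s + 1)" for I' J'
    using that by (auto simp: nsets_def)
  then show ?thesis
    unfolding incidence_pluecker_def by (simp add: min_attained_twice_image_iff)
qed

text \<open>In the relation for \<open>I - {i}\<close> and \<open>insert i J\<close>, the entry at
  \<open>i\<close> is \<open>\<mu> I + \<nu> J\<close>, and a rival index is precisely an exchange
  partner \<open>j\<close>. An entry is finite exactly when both of its sets are bases, so the two
  conditions range over the same data.\<close>

lemma incidence_pluecker_iff_valuated_quotient:
  assumes E: "finite E" and \<mu>: "\<mu> \<in> trop_vec (nsets E r)" and \<nu>: "\<nu> \<in> trop_vec (nsets E s)"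
  shows "incidence_pluecker E r \<mu> s \<nu> \<longleftrightarrow> valuated_quotient E r \<mu> s \<nu>"
proof
  assume inc: "incidence_pluecker E r \<mu> s \<nu>"
  show "valuated_quotient E r \<mu> s \<nu>"
    unfolding valuated_quotient_def
  proof (intro ballI)
    fix I J i assume I: "I \<in> val_bases E r \<mu>" and J: "J \<in> val_bases E s \<nu>" and i: "i \<in> I - J"
    let ?I = "I - {i}" and ?J = "insert i J"
    have eq: "insert i ?I = I" "?J - {i} = J"
      using i by auto
    have "?I \<subseteq> E" "?J \<in> nsets E (s + 1)" "card ?I + 1 = r" "i \<in> ?J - ?I"
      using val_basesD[OF I] val_basesD[OF J] i card_Suc_Diff1[of I i] by (auto simp: nsets_def)
    moreover have "\<mu> (insert i ?I) + \<nu> (?J - {i}) \<noteq> \<infinity>"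
      using val_basesD[OF I] val_basesD[OF J] by (simp add: eq del: insert_Diff_single)
    ultimately obtain j where j: "j \<in> ?J - ?I" "j \<noteq> i"
      "\<mu> (insert j ?I) + \<nu> (?J - {j}) \<le> \<mu> (insert i ?I) + \<nu> (?J - {i})"
      using inc unfolding incidence_pluecker_iff[OF E] by blast
    moreover have "?J - {j} = insert i (J - {j})"
      using j by auto
    ultimately show "\<exists>j\<in>J - I. \<mu> (insert j ?I) + \<nu> (insert i (J - {j})) \<le> \<mu> I + \<nu> J"
      unfolding eq by (intro bexI[of _ j]) auto
  qed
next
  assume q: "valuated_quotient E r \<mu> s \<nu>"
  show "incidence_pluecker E r \<mu> s \<nu>"
    unfolding incidence_pluecker_iff[OF E]
  proof (intro allI ballI impI)
    fix I' J' i assume I': "I' \<subseteq> E" "card I' + 1 = r" and J': "J' \<in> nsets E (s + 1)"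
      and i: "i \<in> J' - I'" and fin: "\<mu> (insert i I') + \<nu> (J' - {i}) \<noteq> \<infinity>"
    have "insert i I' \<in> val_bases E r \<mu>" "J' - {i} \<in> val_bases E s \<nu>"
      using I' J' i fin E finite_subset[OF I'(1) E] by (auto simp: val_bases_def nsets_def)
    moreover have "i \<in> insert i I' - (J' - {i})"
      by simp
    ultimately obtain j where j: "j \<in> (J' - {i}) - insert i I'"
      "\<mu> (insert j (insert i I' - {i})) + \<nu> (insert i (J' - {i} - {j})) \<le>
        \<mu> (insert i I') + \<nu> (J' - {i})"
      using q unfolding valuated_quotient_def by blast
    moreover have "insert i I' - {i} = I'" "insert i (J' - {i} - {j}) = J' - {j}"
      using i j by auto
    ultimately show "\<exists>j\<in>J' - I'. j \<noteq> i \<and>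
        \<mu> (insert j I') + \<nu> (J' - {j}) \<le> \<mu> (insert i I') + \<nu> (J' - {i})"
      by (intro bexI[of _ j]) auto
  qed
qed

text \<open>This is the incidence relation of \<open>\<mu>\<close> with itself at
  \<open>I - {i}\<close> and \<open>insert i J\<close>. Its entry at \<open>i\<close> is the
  separate term \<open>\<mu> I + \<mu> J\<close>, and the other entries are indexed by
  \<open>J - I\<close>.\<close>

lemma valuated_matroid_imp_grassmann_pluecker:
  assumes "valuated_matroid E r \<mu>"
  shows "grassmann_pluecker E r \<mu>"
  unfolding grassmann_pluecker_def
proof (intro ballI impI)
  fix I J i assume I: "I \<in> nsets E r" and J: "J \<in> nsets E r" and i: "i \<in> I - J"
  note E = valuated_matroidD(1)[OF assms] and \<mu> = valuated_matroidD(2)[OF assms]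
  have inc: "incidence_pluecker E r \<mu> r \<mu>"
    using incidence_pluecker_iff_valuated_quotient[OF E \<mu> \<mu>] valuated_matroid_imp_quotient[OF assms]
    by blast
  have "card (I - {i}) + 1 = r" "I - {i} \<subseteq> E" "insert i J \<in> nsets E (r + 1)"
    using I J i card_Suc_Diff1[of I i] by (auto simp: nsets_def)
  then have tw: "min_attained_twice
      {# \<mu> (insert j (I - {i})) + \<mu> (insert i J - {j}). j \<in># mset_set (insert i J - (I - {i})) #}"
    using inc unfolding incidence_pluecker_def by blast
  have "insert i J - (I - {i}) = insert i (J - I)"
    using i by auto
  moreover have "finite (J - I)" "i \<notin> J - I"
    using J i by (auto simp: nsets_def)
  ultimately have "mset_set (insert i J - (I - {i})) = add_mset i (mset_set (J - I))"
    by simp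
  moreover have "insert i (I - {i}) = I" "insert i J - {i} = J"
    using i by auto
  moreover have "{# \<mu> (insert j (I - {i})) + \<mu> (insert i J - {j}). j \<in># mset_set (J - I) #} =
      {# \<mu> (insert j (I - {i})) + \<mu> (insert i (J - {j})). j \<in># mset_set (J - I) #}"
  proof (rule image_mset_cong)
    fix j assume "j \<in># mset_set (J - I)"
    then have "insert i J - {j} = insert i (J - {j})"
      using i \<open>finite (J - I)\<close> by auto
    then show "\<mu> (insert j (I - {i})) + \<mu> (insert i J - {j}) =
        \<mu> (insert j (I - {i})) + \<mu> (insert i (J - {j}))"
      by simp
  qed
  ultimately show "min_attained_twice (add_mset (\<mu> I + \<mu> J)
        {# \<mu> (insert j (I - {i})) + \<mu> (insert i (J - {j})). j \<in># mset_set (J - I) #})"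
    using tw by simp
qed

section \<open>Tropical orthogonality and initial bases\<close>

text \<open>Membership in \<open>L(\<mu>)\<close>, in the local form of a minimum attained twice.
  Since infinite entries demand nothing, the sets \<open>S\<close> whose circuit vector is all
  infinite need no exclusion, and \<open>u\<close> may have infinite coordinates.\<close>

definition trop_orthogonal :: "'a set \<Rightarrow> nat \<Rightarrow> ('a set \<Rightarrow> ereal) \<Rightarrow> ('a \<Rightarrow> ereal) \<Rightarrow> bool"
  where "trop_orthogonal E r \<mu> u \<longleftrightarrow> (\<forall>S\<in>nsets E (r + 1). \<forall>i\<in>S. \<mu> (S - {i}) + u i \<noteq> \<infinity> \<longrightarrow>
    (\<exists>j\<in>S. j \<noteq> i \<and> \<mu> (S - {j}) + u j \<le> \<mu> (S - {i}) + u i))"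

text \<open>For a valuated matroid these are the bases of the initial matroid at \<open>w\<close>,
  the cell that \<open>w\<close> selects in the subdivision of the base polytope induced by
  \<open>\<mu>\<close>.\<close>

definition initial_bases :: "'a set \<Rightarrow> nat \<Rightarrow> ('a set \<Rightarrow> ereal) \<Rightarrow> ('a \<Rightarrow> real) \<Rightarrow> 'a set set"
  where "initial_bases E r \<mu> w = {B \<in> val_bases E r \<mu>. \<forall>B'\<in>val_bases E r \<mu>.
    \<mu> B + ereal (sum w B) \<le> \<mu> B' + ereal (sum w B')}"

lemma initial_bases_nonempty:
  assumes "finite E" "val_bases E r \<mu> \<noteq> {}"
  shows "initial_bases E r \<mu> w \<noteq> {}"
proof -
  obtain B where "B \<in> val_bases E r \<mu>"
    "\<And>B'. B' \<in> val_bases E r \<mu> \<Longrightarrow> \<not> \<mu> B' + ereal (sum w B') < \<mu> B + ereal (sum w B)"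
    using ex_is_arg_min_if_finite[OF finite_val_bases[OF assms(1)] assms(2), where
        f = "\<lambda>B. \<mu> B + ereal (sum w B)"]
    unfolding is_arg_min_def by blast
  then show ?thesis
    by (auto simp: initial_bases_def not_less)
qed

lemma sum_exchange:
  fixes w :: "'a \<Rightarrow> real"
  assumes "finite B" "i \<in> B" "j \<notin> B - {i}"
  shows "sum w (insert j (B - {i})) = sum w B - w i + w j"
  using assms by (simp add: sum_diff1)

text \<open>Take any minimizing basis \<open>B\<close>. If it misses \<open>i\<close>, orthogonality
  on \<open>insert i B\<close> at the entry \<open>i\<close> yields some \<open>j\<close> to be
  replaced by \<open>i\<close>. Because \<open>w\<close> is \<open>-u\<close> on the support, the
  comparison of the two entries says that this replacement does not increase the weight.\<close>

lemma trop_orthogonal_imp_initial_basis: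
  assumes E: "finite E" and \<mu>: "\<mu> \<in> trop_vec (nsets E r)" and ne: "val_bases E r \<mu> \<noteq> {}"
    and u: "\<And>j. j \<in> E \<Longrightarrow> u j \<noteq> -\<infinity>" and orth: "trop_orthogonal E r \<mu> u"
    and w: "\<And>j. j \<in> E \<Longrightarrow> u j \<noteq> \<infinity> \<Longrightarrow> u j = ereal (- w j)"
    and i: "i \<in> E" "u i \<noteq> \<infinity>"
  obtains B where "B \<in> initial_bases E r \<mu> w" "i \<in> B"
proof -
  obtain B where B: "B \<in> initial_bases E r \<mu> w"
    using initial_bases_nonempty[OF E ne] by blast
  show thesis
  proof (cases "i \<in> B")
    case True
    with B show thesis
      by (rule that)
  next
    case False
    have Bb: "B \<in> val_bases E r \<mu>"
      using B by (simp add: initial_bases_def)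
    let ?S = "insert i B"
    have S: "?S \<in> nsets E (r + 1)" "?S - {i} = B"
      using Bb False i(1) nsets_insert[of B E r i] by (auto simp: val_bases_def)
    obtain x where x: "\<mu> B = ereal x"
      using val_bases_real[OF \<mu> Bb] by blast
    have "\<mu> (?S - {i}) + u i \<noteq> \<infinity>"
      unfolding S(2) using x i w by simp
    then obtain j where j: "j \<in> ?S" "j \<noteq> i" "\<mu> (?S - {j}) + u j \<le> \<mu> B + u i"
      using orth S unfolding trop_orthogonal_def by (metis insertI1)
    have Sj: "?S - {j} = insert i (B - {j})"
      using j False by auto
    have n: "insert i (B - {j}) \<in> nsets E r"
      using Bb j i False by (intro nsets_exchange) (auto simp: val_bases_def)
    have jE: "j \<in> E"
      using j val_basesD[OF Bb] by auto
    \<comment> \<open>The finite bound puts \<open>j\<close> into the support of \<open>u\<close>,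
      where \<open>w\<close> is prescribed, and makes the exchanged set a basis.\<close>
    have le: "\<mu> (insert i (B - {j})) + u j \<le> ereal (x - w i)"
      using j(3) x w[OF i] by (simp add: Sj)
    then have uj: "u j \<noteq> \<infinity>" and mj: "\<mu> (insert i (B - {j})) \<noteq> \<infinity>"
      using trop_vec_not_MInf[OF \<mu> n] u[OF jE] by auto
    have B': "insert i (B - {j}) \<in> val_bases E r \<mu>"
      using n mj by (simp add: val_bases_def)
    then obtain y where y: "\<mu> (insert i (B - {j})) = ereal y"
      using val_bases_real[OF \<mu>] by blast
    have "y - w j \<le> x - w i"
      using le y w[OF jE uj] by simp
    moreover have "sum w (insert i (B - {j})) = sum w B - w j + w i"
      using j False val_basesD[OF Bb] by (intro sum_exchange) auto
    ultimately have "\<mu> (insert i (B - {j})) + ereal (sum w (insert i (B - {j}))) \<le> \<mu> B + ereal (sum w B)"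
      using x y by simp
    then have "insert i (B - {j}) \<in> initial_bases E r \<mu> w"
      using B B' unfolding initial_bases_def by (auto intro: order_trans)
    then show thesis
      by (rule that) simp
  qed
qed

text \<open>The hypothesis says that \<open>u\<close> is the minimum of the translates of the cocircuit
  vectors \<open>j \<mapsto> \<mu> (B - i \<union> j)\<close> that agree with \<open>u\<close> at \<open>i\<close>.\<close>

lemma trop_orthogonal_if_min_of_cocircuits:
  assumes val: "valuated_matroid E r \<mu>"
    and u: "\<And>j. j \<in> E \<Longrightarrow> u j \<noteq> -\<infinity>"
    and cocircuits: "\<And>i. i \<in> E \<Longrightarrow> u i \<noteq> \<infinity> \<Longrightarrow> \<exists>B\<in>val_bases E r \<mu>. i \<in> B \<and>
      (\<forall>j\<in>E - B. u j + \<mu> B \<le> \<mu> (insert j (B - {i})) + u i)"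
  shows "trop_orthogonal E r \<mu> u"
  unfolding trop_orthogonal_def
proof (intro ballI impI)
  fix S i assume S: "S \<in> nsets E (r + 1)" and i: "i \<in> S" and fin: "\<mu> (S - {i}) + u i \<noteq> \<infinity>"
  note \<mu> = valuated_matroidD(2)[OF val]
  have iE: "i \<in> E" and ui: "u i \<noteq> \<infinity>" and J: "S - {i} \<in> val_bases E r \<mu>"
    using S i fin nsets_remove[OF S i] by (auto simp: val_bases_def) (auto simp: nsets_def)
  obtain B where B: "B \<in> val_bases E r \<mu>" "i \<in> B"
    and co: "\<And>j. j \<in> E - B \<Longrightarrow> u j + \<mu> B \<le> \<mu> (insert j (B - {i})) + u i"
    using cocircuits[OF iE ui] by blast
  \<comment> \<open>Symmetric exchange of \<open>i\<close> between \<open>B\<close> and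
    \<open>S - {i}\<close> supplies the rival \<open>j\<close>. Adding the exchange inequality to
    the cocircuit bound at \<open>j\<close> and cancelling the values of \<open>B\<close> and of
    \<open>insert j (B - {i})\<close> compares the entries of \<open>S\<close> at \<open>j\<close>
    and \<open>i\<close>.\<close>
  have "i \<in> B - (S - {i})"
    using B by simp
  then obtain j where j: "j \<in> S - {i} - B" "insert j (B - {i}) \<in> val_bases E r \<mu>"
      "insert i (S - {i} - {j}) \<in> val_bases E r \<mu>"
      "\<mu> (insert j (B - {i})) + \<mu> (insert i (S - {i} - {j})) \<le> \<mu> B + \<mu> (S - {i})"
    using valuated_quotient_exchange[OF valuated_matroid_imp_quotient[OF val] \<mu> \<mu> B(1) J] by metis
  have eq: "insert i (S - {i} - {j}) = S - {j}"
    using i j by auto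
  have jE: "j \<in> E"
    using j S by (auto simp: nsets_def)
  obtain a b c d where abcd: "\<mu> B = ereal a" "\<mu> (S - {i}) = ereal b"
      "\<mu> (insert j (B - {i})) = ereal c" "\<mu> (S - {j}) = ereal d"
    using val_bases_real[OF \<mu>] B J j(2,3) unfolding eq by metis
  obtain e where e: "u i = ereal e"
    using ui u[OF iE] by (cases "u i") auto
  have "u j + \<mu> B \<le> \<mu> (insert j (B - {i})) + u i"
    using co j jE by blast
  then have uj: "u j + ereal a \<le> ereal (c + e)"
    using abcd e by simp
  then obtain f where f: "u j = ereal f"
    using u[OF jE] by (cases "u j") auto
  have "c + d \<le> a + b"
    using j(4) abcd unfolding eq by simp
  then have "\<mu> (S - {j}) + u j \<le> \<mu> (S - {i}) + u i"
    using uj abcd e f by simp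
  then show "\<exists>j\<in>S. j \<noteq> i \<and> \<mu> (S - {j}) + u j \<le> \<mu> (S - {i}) + u i"
    using j by blast
qed

text \<open>Converse to \<open>trop_orthogonal_imp_initial_basis\<close>. Minimality of a basis
  \<open>B\<close> containing \<open>i\<close> against its neighbours
  \<open>insert j (B - {i})\<close> is the bound on cocircuit entries for \<open>j\<close> in the
  support. The values of \<open>w\<close> off the support are free, and a suitable choice keeps such
  neighbours from being bases.\<close>

lemma trop_orthogonal_if_initial_bases_cover:
  assumes val: "valuated_matroid E r \<mu>"
    and u: "\<And>j. j \<in> E \<Longrightarrow> u j \<noteq> -\<infinity>"
    and cover: "\<And>w i. (\<And>j. j \<in> E \<Longrightarrow> u j \<noteq> \<infinity> \<Longrightarrow> u j = ereal (- w j)) \<Longrightarrow> i \<in> E \<Longrightarrow> u i \<noteq> \<infinity> \<Longrightarrow>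
      \<exists>B\<in>initial_bases E r \<mu> w. i \<in> B"
  shows "trop_orthogonal E r \<mu> u"
proof (rule trop_orthogonal_if_min_of_cocircuits[OF val u])
  note E = valuated_matroidD(1)[OF val] and \<mu> = valuated_matroidD(2)[OF val]
  fix i assume i: "i \<in> E" "u i \<noteq> \<infinity>"
  define m where "m B = real_of_ereal (\<mu> B)" for B
  \<comment> \<open>A bound \<open>t0\<close> on all differences of \<open>\<mu>\<close> between
    bases. Off the support, \<open>w\<close> will lie \<open>t0 + 1\<close> below
    \<open>w i\<close>, which outweighs any such difference.\<close>
  define X where "X = (\<lambda>(B, B'). m B - m B') ` (val_bases E r \<mu> \<times> val_bases E r \<mu>)"
  have "finite X"
    unfolding X_def using finite_val_bases[OF E] by auto
  then obtain t0 where t0: "\<And>x. x \<in> X \<Longrightarrow> x \<le> t0"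
    using bdd_above_finite[of X] by (auto simp: bdd_above_def)
  \<comment> \<open>So large a value off the support of \<open>u\<close> makes the cocircuit entries there infinite.\<close>
  define w where "w j = (if u j = \<infinity> then - (t0 + real_of_ereal (u i) + 1) else - real_of_ereal (u j))" for j
  have w: "u j = ereal (- w j)" if "j \<in> E" "u j \<noteq> \<infinity>" for j
    using that u[of j] by (cases "u j") (auto simp: w_def)
  obtain B where B: "B \<in> initial_bases E r \<mu> w" "i \<in> B"
    using cover[of w, OF w i] by blast
  have Bb: "B \<in> val_bases E r \<mu>"
    using B by (simp add: initial_bases_def)
  obtain x where x: "\<mu> B = ereal x"
    using val_bases_real[OF \<mu> Bb] .
  have "u j + \<mu> B \<le> \<mu> (insert j (B - {i})) + u i" if j: "j \<in> E - B" for j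
  proof (cases "insert j (B - {i}) \<in> val_bases E r \<mu>")
    case False
    moreover have "insert j (B - {i}) \<in> nsets E r"
      using Bb B j by (intro nsets_exchange) (auto simp: val_bases_def)
    ultimately show ?thesis
      using w[OF i] by (simp add: val_bases_def)
  next
    case True
    then obtain y where y: "\<mu> (insert j (B - {i})) = ereal y"
      using val_bases_real[OF \<mu>] by blast
    have "m (insert j (B - {i})) - m B \<in> X"
      using True Bb by (auto simp: X_def)
    then have "y - x \<le> t0"
      using t0 x y by (simp add: m_def)
    have "\<mu> B + ereal (sum w B) \<le> \<mu> (insert j (B - {i})) + ereal (sum w (insert j (B - {i})))"
      using B True by (simp add: initial_bases_def)
    moreover have "sum w (insert j (B - {i})) = sum w B - w i + w j"
      using j B val_basesD[OF Bb] by (intro sum_exchange) auto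
    ultimately have le: "x \<le> y - w i + w j"
      using x y by simp
    \<comment> \<open>Otherwise exchanging \<open>i\<close> for \<open>j\<close> would lower the
      weight of the minimizer \<open>B\<close> by at least 1.\<close>
    have "u j \<noteq> \<infinity>"
    proof
      assume "u j = \<infinity>"
      then have "w j = - (t0 + real_of_ereal (u i) + 1)"
        by (simp add: w_def)
      moreover have "w i = - real_of_ereal (u i)"
        using i by (simp add: w_def)
      ultimately show False
        using le \<open>y - x \<le> t0\<close> by simp
    qed
    then show ?thesis
      using le w[OF i] w[of j] j x y by simp
  qed
  then show "\<exists>B\<in>val_bases E r \<mu>. i \<in> B \<and> (\<forall>j\<in>E - B. u j + \<mu> B \<le> \<mu> (insert j (B - {i})) + u i)"
    using Bb B by blast
qed

section \<open>Quotients of initial matroids\<close>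

text \<open>If \<open>i\<close> lay in no member of \<open>N\<close>, then \<open>{i}\<close> would
  be a circuit of \<open>N\<close>. A union of circuits of \<open>M\<close> equal to
  \<open>{i}\<close> has to contain \<open>{i}\<close> itself, which would make \<open>i\<close> a
  loop of \<open>M\<close> too.\<close>

lemma matroid_quotient_nonloop:
  assumes q: "matroid_quotient E M N" and "N \<noteq> {}" and i: "i \<in> E" "B \<in> M" "i \<in> B"
  shows "\<exists>B'\<in>N. i \<in> B'"
proof (rule ccontr)
  assume "\<not> (\<exists>B'\<in>N. i \<in> B')"
  then have "{i} \<in> circuits E N"
    using \<open>N \<noteq> {}\<close> i(1) by (auto simp: circuits_def indep_def)
  then obtain D where D: "D \<subseteq> circuits E M" "{i} = \<Union>D"
    using q unfolding matroid_quotient_def by blast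
  then obtain C where C: "C \<in> D" "i \<in> C"
    by blast
  with D have "C = {i}"
    by blast
  with C D have "\<not> indep M {i}"
    by (auto simp: circuits_def)
  then show False
    using i by (auto simp: indep_def)
qed

text \<open>Orthogonality amounts to the support being covered by initial bases for every real
  \<open>w\<close> extending \<open>-u\<close>, and such a covering passes along quotients because
  non-loops do.\<close>

lemma trop_orthogonal_mono_if_initial_quotients:
  assumes \<mu>: "valuated_matroid E r \<mu>" and \<nu>: "valuated_matroid E s \<nu>"
    and q: "\<And>w. matroid_quotient E (initial_bases E r \<mu> w) (initial_bases E s \<nu> w)"
    and u: "\<And>j. j \<in> E \<Longrightarrow> u j \<noteq> -\<infinity>" and orth: "trop_orthogonal E r \<mu> u"
  shows "trop_orthogonal E s \<nu> u"
proof (rule trop_orthogonal_if_initial_bases_cover[OF \<nu> u])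
  fix w i assume w: "\<And>j. j \<in> E \<Longrightarrow> u j \<noteq> \<infinity> \<Longrightarrow> u j = ereal (- w j)" and i: "i \<in> E" "u i \<noteq> \<infinity>"
  obtain B where "B \<in> initial_bases E r \<mu> w" "i \<in> B"
    using trop_orthogonal_imp_initial_basis[OF valuated_matroidD[OF \<mu>] u orth w i] by blast
  then show "\<exists>B\<in>initial_bases E s \<nu> w. i \<in> B"
    using matroid_quotient_nonloop[OF q initial_bases_nonempty[OF valuated_matroidD(1,3)[OF \<nu>]] i(1)]
    by blast
qed

text \<open>The swap moves \<open>i\<close> and \<open>j\<close> between the two bases, so the
  \<open>w\<close>-terms cancel in the total and the total weight does not grow. Neither basis can
  become lighter, since both are minimizers. Hence both weights are preserved.\<close>

lemma initial_bases_exchange: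
  assumes q: "valuated_quotient E r \<mu> s \<nu>"
    and \<mu>: "\<mu> \<in> trop_vec (nsets E r)" and \<nu>: "\<nu> \<in> trop_vec (nsets E s)"
    and I: "I \<in> initial_bases E r \<mu> w" and J: "J \<in> initial_bases E s \<nu> w" and i: "i \<in> I - J"
  shows "\<exists>j\<in>J - I. insert j (I - {i}) \<in> initial_bases E r \<mu> w \<and>
    insert i (J - {j}) \<in> initial_bases E s \<nu> w"
proof -
  have Ib: "I \<in> val_bases E r \<mu>" and Jb: "J \<in> val_bases E s \<nu>"
    using I J by (auto simp: initial_bases_def)
  obtain j where j: "j \<in> J - I" "insert j (I - {i}) \<in> val_bases E r \<mu>"
      "insert i (J - {j}) \<in> val_bases E s \<nu>"
      "\<mu> (insert j (I - {i})) + \<nu> (insert i (J - {j})) \<le> \<mu> I + \<nu> J"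
    using valuated_quotient_exchange[OF q \<mu> \<nu> Ib Jb i] .
  obtain a b c d where abcd: "\<mu> I = ereal a" "\<nu> J = ereal b"
      "\<mu> (insert j (I - {i})) = ereal c" "\<nu> (insert i (J - {j})) = ereal d"
    using val_bases_real[OF \<mu>] val_bases_real[OF \<nu>] Ib Jb j(2,3) by metis
  have sums: "sum w (insert j (I - {i})) = sum w I - w i + w j"
    "sum w (insert i (J - {j})) = sum w J - w j + w i"
    using i j val_basesD(2)[OF Ib] val_basesD(2)[OF Jb] by (intro sum_exchange; blast)+
  have "\<mu> I + ereal (sum w I) \<le> \<mu> (insert j (I - {i})) + ereal (sum w (insert j (I - {i})))"
    "\<nu> J + ereal (sum w J) \<le> \<nu> (insert i (J - {j})) + ereal (sum w (insert i (J - {j})))"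
    using I J j by (simp_all add: initial_bases_def)
  then have "\<mu> (insert j (I - {i})) + ereal (sum w (insert j (I - {i}))) = \<mu> I + ereal (sum w I)"
    "\<nu> (insert i (J - {j})) + ereal (sum w (insert i (J - {j}))) = \<nu> J + ereal (sum w J)"
    using j(4) unfolding sums by (auto simp: abcd)
  then show ?thesis
    using I J j(1,2,3) unfolding initial_bases_def by (intro bexI[of _ j]) auto
qed

lemma ex_circuit_subset:
  assumes "X \<subseteq> E" "finite X" "\<not> indep M X"
  shows "\<exists>C\<in>circuits E M. C \<subseteq> X"
proof -
  let ?A = "{C. C \<subseteq> X \<and> \<not> indep M C}"
  have fin: "finite ?A" and ne: "?A \<noteq> {}"
    using assms by auto
  obtain C where CA: "C \<in> ?A" and min: "\<forall>Y\<in>?A. Y \<subseteq> C \<longrightarrow> C = Y"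
    by (rule bexE[OF finite_has_minimal[OF fin ne]])
  then have C: "C \<subseteq> X" "\<not> indep M C"
    by simp_all
  have "indep M Y" if "Y \<subset> C" for Y
    using bspec[OF min, of Y] that C(1) by auto
  then have "C \<in> circuits E M"
    using C assms(1) by (auto simp: circuits_def)
  then show ?thesis
    using C(1) by blast
qed

text \<open>Suppose \<open>x\<close> in a circuit \<open>C\<close> of \<open>N\<close> lies on no
  circuit of \<open>M\<close> inside \<open>C\<close>. Then some basis of \<open>M\<close> that
  meets \<open>C - {x}\<close> maximally also contains \<open>x\<close>. Exchanging \<open>x\<close>
  against a basis of \<open>N\<close> containing \<open>C - {x}\<close> would enlarge that maximal
  intersection.\<close>

lemma matroid_quotient_if_exchange:
  assumes E: "finite E" "M \<subseteq> Pow E" "M \<noteq> {}"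
    and exch: "\<And>I J i. I \<in> M \<Longrightarrow> J \<in> N \<Longrightarrow> i \<in> I - J \<Longrightarrow>
      \<exists>j\<in>J - I. insert j (I - {i}) \<in> M \<and> insert i (J - {j}) \<in> N"
  shows "matroid_quotient E M N"
proof -
  have "\<exists>D\<in>circuits E M. x \<in> D \<and> D \<subseteq> C" if C: "C \<in> circuits E N" and x: "x \<in> C" for C x
  proof (rule ccontr)
    assume no: "\<not> (\<exists>D\<in>circuits E M. x \<in> D \<and> D \<subseteq> C)"
    let ?Y = "C - {x}"
    have finM: "finite M"
      using E by (meson finite_Pow_iff finite_subset)
    have "Max ((\<lambda>I. card (I \<inter> ?Y)) ` M) \<in> (\<lambda>I. card (I \<inter> ?Y)) ` M"
      using finM E(3) by (intro Max_in) auto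
    then obtain I where I: "I \<in> M" "card (I \<inter> ?Y) = Max ((\<lambda>I. card (I \<inter> ?Y)) ` M)"
      by auto
    have max: "card (I' \<inter> ?Y) \<le> card (I \<inter> ?Y)" if "I' \<in> M" for I'
      using that finM unfolding I(2) by simp
    have CE: "C \<subseteq> E" "finite C"
      using C E(1) by (auto simp: circuits_def intro: finite_subset)
    \<comment> \<open>A circuit of \<open>M\<close> in this set must contain \<open>x\<close>,
      because the rest lies in the basis \<open>I\<close>. It would also lie in \<open>C\<close>,
      contrary to \<open>no\<close>.\<close>
    have "indep M (insert x (I \<inter> ?Y))"
    proof (rule ccontr)
      assume "\<not> ?thesis"
      then obtain D where D: "D \<in> circuits E M" "D \<subseteq> insert x (I \<inter> ?Y)"
        using ex_circuit_subset[of "insert x (I \<inter> ?Y)" E M] CE x by auto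
      have "x \<in> D"
      proof (rule ccontr)
        assume "x \<notin> D"
        then have "D \<subseteq> I"
          using D by blast
        then show False
          using D I(1) by (auto simp: circuits_def indep_def)
      qed
      then show False
        using no D x by blast
    qed
    then obtain I2 where I2: "I2 \<in> M" "insert x (I \<inter> ?Y) \<subseteq> I2"
      by (auto simp: indep_def)
    have max2: "card (I' \<inter> ?Y) \<le> card (I2 \<inter> ?Y)" if "I' \<in> M" for I'
    proof -
      have "card (I \<inter> ?Y) \<le> card (I2 \<inter> ?Y)"
        using I2 CE by (intro card_mono) auto
      then show ?thesis
        using max[OF that] by simp
    qed
    have "indep N ?Y"
      using C x unfolding circuits_def by blast
    then obtain J where J: "J \<in> N" "?Y \<subseteq> J"
      by (auto simp: indep_def)
    have "x \<notin> J"
      using C J by (auto simp: circuits_def indep_def)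
    then obtain j where j: "j \<in> J - I2" "insert j (I2 - {x}) \<in> M" "insert x (J - {j}) \<in> N"
      using exch[OF I2(1) J(1), of x] I2 by blast
    \<comment> \<open>The dependent set \<open>C\<close> does not fit into a basis of
      \<open>N\<close>. As \<open>C\<close> lies in \<open>insert x J\<close>, the removed element
      \<open>j\<close> must belong to \<open>C - {x}\<close>.\<close>
    have "\<not> C \<subseteq> insert x (J - {j})"
      using C j by (auto simp: circuits_def indep_def)
    then have "j \<in> ?Y"
      using J x by blast
    then have "insert j (I2 - {x}) \<inter> ?Y = insert j (I2 \<inter> ?Y)"
      by auto
    then have "card (insert j (I2 - {x}) \<inter> ?Y) = card (I2 \<inter> ?Y) + 1"
      using j CE by simp
    then show False
      using max2[OF j(2)] by simp
  qed
  then have "C = \<Union>{D\<in>circuits E M. D \<subseteq> C}" if "C \<in> circuits E N" for C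
    using that by blast
  then show ?thesis
    unfolding matroid_quotient_def by (intro ballI exI[of _ "{D\<in>circuits E M. D \<subseteq> C}" for C] conjI) auto
qed

lemma initial_bases_matroid:
  assumes "valuated_matroid E r \<mu>"
  shows "matroid E (initial_bases E r \<mu> w)"
proof -
  note \<mu> = valuated_matroidD[OF assms]
  have "initial_bases E r \<mu> w \<subseteq> Pow E"
    by (auto simp: initial_bases_def dest: val_basesD)
  moreover have "\<exists>j\<in>B' - B. insert j (B - {i}) \<in> initial_bases E r \<mu> w"
    if "B \<in> initial_bases E r \<mu> w" "B' \<in> initial_bases E r \<mu> w" "i \<in> B - B'" for B B' i
    using initial_bases_exchange[OF valuated_matroid_imp_quotient[OF assms] \<mu>(2) \<mu>(2) that] by blast
  ultimately show ?thesis
    using \<mu>(1) initial_bases_nonempty[OF \<mu>(1,3)] unfolding matroid_def by simp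
qed

lemma initial_bases_quotient:
  assumes \<mu>: "valuated_matroid E r \<mu>" and \<nu>: "valuated_matroid E s \<nu>"
    and q: "valuated_quotient E r \<mu> s \<nu>"
  shows "matroid_quotient E (initial_bases E r \<mu> w) (initial_bases E s \<nu> w)"
proof (rule matroid_quotient_if_exchange)
  show "finite E"
    by (rule valuated_matroidD(1)[OF \<mu>])
  show "initial_bases E r \<mu> w \<subseteq> Pow E"
    by (auto simp: initial_bases_def dest: val_basesD)
  show "initial_bases E r \<mu> w \<noteq> {}"
    by (rule initial_bases_nonempty[OF valuated_matroidD(1,3)[OF \<mu>]])
qed (rule initial_bases_exchange[OF q valuated_matroidD(2)[OF \<mu>] valuated_matroidD(2)[OF \<nu>]])

section \<open>Restriction and contraction of valuated matroids\<close>

lemma max_meeting_basesD: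
  assumes "B \<in> max_meeting_bases \<B> S"
  shows "B \<in> \<B>" "\<And>B'. B' \<in> \<B> \<Longrightarrow> card (B' \<inter> S) \<le> card (B \<inter> S)"
  using assms by (auto simp: max_meeting_bases_def)

lemma max_meeting_bases_card_eq:
  assumes "B \<in> max_meeting_bases \<B> S" "B' \<in> max_meeting_bases \<B> S"
  shows "card (B \<inter> S) = card (B' \<inter> S)"
  using assms by (meson max_meeting_basesD order_antisym)

lemma max_meeting_basesI:
  assumes "B \<in> max_meeting_bases \<B> S" "B' \<in> \<B>" "card (B' \<inter> S) = card (B \<inter> S)"
  shows "B' \<in> max_meeting_bases \<B> S"
  using assms by (simp add: max_meeting_bases_def)

lemma max_meeting_bases_nonempty:
  assumes "finite \<B>" "\<B> \<noteq> {}"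
  shows "max_meeting_bases \<B> S \<noteq> {}"
proof -
  have "Max ((\<lambda>B. card (B \<inter> S)) ` \<B>) \<in> (\<lambda>B. card (B \<inter> S)) ` \<B>"
    using assms by (intro Max_in) auto
  then obtain B where B: "B \<in> \<B>" "card (B \<inter> S) = Max ((\<lambda>B. card (B \<inter> S)) ` \<B>)"
    by auto
  then have "B \<in> max_meeting_bases \<B> S"
    using assms by (simp add: max_meeting_bases_def)
  then show ?thesis
    by blast
qed

lemma matroid_rank_eq:
  assumes "finite \<B>" "B \<in> max_meeting_bases \<B> S"
  shows "matroid_rank \<B> S = card (B \<inter> S)"
  unfolding matroid_rank_def using assms max_meeting_basesD[OF assms(2)] by (intro Max_eqI) auto

text \<open>If the partner \<open>j\<close> of an element \<open>i\<close> of \<open>S\<close> lay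
  outside \<open>S\<close>, then \<open>insert i (B' - {j})\<close> would meet \<open>S\<close> in
  one element more than the maximum. So \<open>j\<close> lies in \<open>S\<close>, and
  \<open>insert j (B - {i})\<close> still meets \<open>S\<close> maximally.\<close>

lemma max_meeting_bases_exchange:
  assumes val: "valuated_matroid E r \<mu>"
    and B: "B \<in> max_meeting_bases (val_bases E r \<mu>) S"
    and B': "B' \<in> max_meeting_bases (val_bases E r \<mu>) S" and i: "i \<in> B \<inter> S - B'"
  obtains j where "j \<in> B' \<inter> S - B" "insert j (B - {i}) \<in> max_meeting_bases (val_bases E r \<mu>) S"
    "\<mu> (insert j (B - {i})) + \<mu> (insert i (B' - {j})) \<le> \<mu> B + \<mu> B'"
proof -
  note \<mu> = valuated_matroidD(2)[OF val]
  have fin: "finite B" "finite B'"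
    using max_meeting_basesD(1)[OF B] max_meeting_basesD(1)[OF B'] by (auto dest: val_basesD)
  have "i \<in> B - B'"
    using i by blast
  then obtain j where j: "j \<in> B' - B" "insert j (B - {i}) \<in> val_bases E r \<mu>"
      "insert i (B' - {j}) \<in> val_bases E r \<mu>"
      "\<mu> (insert j (B - {i})) + \<mu> (insert i (B' - {j})) \<le> \<mu> B + \<mu> B'"
    using valuated_quotient_exchange[OF valuated_matroid_imp_quotient[OF val] \<mu> \<mu>
        max_meeting_basesD(1)[OF B] max_meeting_basesD(1)[OF B']] by metis
  have "j \<in> S"
  proof (rule ccontr)
    assume "j \<notin> S"
    then have "insert i (B' - {j}) \<inter> S = insert i (B' \<inter> S)"
      using i by auto
    then have "card (insert i (B' - {j}) \<inter> S) = card (B' \<inter> S) + 1"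
      using i fin by simp
    then show False
      using max_meeting_basesD(2)[OF B' j(3)] by simp
  qed
  then have "insert j (B - {i}) \<inter> S = insert j ((B \<inter> S) - {i})"
    by auto
  moreover have "card (insert j ((B \<inter> S) - {i})) = card (B \<inter> S)"
    using i j fin card_Suc_Diff1[of "B \<inter> S" i] by (subst card_insert_disjoint) auto
  ultimately have "insert j (B - {i}) \<in> max_meeting_bases (val_bases E r \<mu>) S"
    using max_meeting_basesI[OF B j(2)] by simp
  then show thesis
    using j \<open>j \<in> S\<close> by (intro that) auto
qed

text \<open>Bases of the restriction and of the contraction combine freely. Exchanges within
  \<open>S\<close> turn \<open>B' \<inter> S\<close> into \<open>B \<inter> S\<close> one element at
  a time and never touch \<open>B' - S\<close>.\<close>

lemma max_meeting_bases_splice: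
  assumes val: "valuated_matroid E r \<mu>"
    and B: "B \<in> max_meeting_bases (val_bases E r \<mu>) S"
    and B': "B' \<in> max_meeting_bases (val_bases E r \<mu>) S"
  shows "(B \<inter> S) \<union> (B' - S) \<in> max_meeting_bases (val_bases E r \<mu>) S"
  using B'
proof (induction "card (B' \<inter> S - B)" arbitrary: B' rule: less_induct)
  case less
  have fin: "finite B" "finite B'"
    using max_meeting_basesD(1)[OF B] max_meeting_basesD(1)[OF less.prems] by (auto dest: val_basesD)
  show ?case
  proof (cases "B' \<inter> S - B = {}")
    case True
    then have "B' \<inter> S = B \<inter> S"
      using max_meeting_bases_card_eq[OF B less.prems] fin by (intro card_subset_eq) auto
    then have "(B \<inter> S) \<union> (B' - S) = B'"
      by auto
    then show ?thesis
      using less.prems by simp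
  next
    case False
    then obtain i where i: "i \<in> B' \<inter> S - B"
      by blast
    obtain j where j: "j \<in> B \<inter> S - B'" "insert j (B' - {i}) \<in> max_meeting_bases (val_bases E r \<mu>) S"
      using max_meeting_bases_exchange[OF val less.prems B i] by metis
    have "insert j (B' - {i}) \<inter> S - B \<subset> B' \<inter> S - B"
      using i j by auto
    then have "card (insert j (B' - {i}) \<inter> S - B) < card (B' \<inter> S - B)"
      using fin by (intro psubset_card_mono) auto
    from less.hyps[OF this j(2)] have
      "(B \<inter> S) \<union> (insert j (B' - {i}) - S) \<in> max_meeting_bases (val_bases E r \<mu>) S" .
    moreover have "insert j (B' - {i}) - S = B' - S"
      using i j by auto
    ultimately show ?thesis
      by simp
  qed
qed

text \<open>Induction on the size of \<open>B \<inter> S - B'\<close>. One exchange yields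
  \<open>B2\<close>, which is closer to \<open>B'\<close> within \<open>S\<close>, and the induction
  hypothesis gives \<open>\<mu> C + \<mu> D \<le> \<mu> B2 + \<mu> B'\<close>. A second exchange,
  between \<open>B\<close> and \<open>D\<close>, gives
  \<open>\<mu> B2 + \<mu> F \<le> \<mu> B + \<mu> D\<close>. The sum of the two is the claim for
  \<open>C\<close> and \<open>F\<close>.\<close>

lemma max_meeting_bases_splice_le:
  assumes val: "valuated_matroid E r \<mu>"
    and B: "B \<in> max_meeting_bases (val_bases E r \<mu>) S"
    and B': "B' \<in> max_meeting_bases (val_bases E r \<mu>) S"
  shows "\<mu> ((B' \<inter> S) \<union> (B - S)) + \<mu> ((B \<inter> S) \<union> (B' - S)) \<le> \<mu> B + \<mu> B'"
  using B
proof (induction "card (B \<inter> S - B')" arbitrary: B rule: less_induct)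
  case less
  let ?MM = "max_meeting_bases (val_bases E r \<mu>) S"
  have fin: "finite B" "finite B'"
    using max_meeting_basesD(1)[OF B'] max_meeting_basesD(1)[OF less.prems] by (auto dest: val_basesD)
  have real: "\<exists>x. \<mu> X = ereal x" if "X \<in> ?MM" for X
    using val_bases_real[OF valuated_matroidD(2)[OF val] max_meeting_basesD(1)[OF that]] by blast
  show ?case
  proof (cases "B \<inter> S - B' = {}")
    case True
    then have eq: "B \<inter> S = B' \<inter> S"
      using max_meeting_bases_card_eq[OF B' less.prems] fin by (intro card_subset_eq) auto
    then have "(B' \<inter> S) \<union> (B - S) = B" "(B \<inter> S) \<union> (B' - S) = B'"
      by blast+
    then show ?thesis
      by simp
  next
    case False
    then obtain i where i: "i \<in> B \<inter> S - B'"
      by blast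
    define C where "C = (B' \<inter> S) \<union> (B - S)"
    have C: "C \<in> ?MM"
      unfolding C_def by (rule max_meeting_bases_splice[OF val B' less.prems])
    have "i \<in> B \<inter> S - C"
      using i by (auto simp: C_def)
    then obtain j where j: "j \<in> C \<inter> S - B" "insert j (B - {i}) \<in> ?MM"
      using max_meeting_bases_exchange[OF val less.prems C] by metis
    define B2 where "B2 = insert j (B - {i})"
    have B2: "B2 \<in> ?MM"
      using j by (simp add: B2_def)
    have jB': "j \<in> B'" "j \<in> S" "j \<notin> B"
      using j by (auto simp: C_def)
    have "B2 \<inter> S - B' \<subset> B \<inter> S - B'"
      using i jB' by (auto simp: B2_def)
    then have "card (B2 \<inter> S - B') < card (B \<inter> S - B')"
      using fin by (intro psubset_card_mono) auto
    from less.hyps[OF this B2]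
    have le1: "\<mu> ((B' \<inter> S) \<union> (B2 - S)) + \<mu> ((B2 \<inter> S) \<union> (B' - S)) \<le> \<mu> B2 + \<mu> B'" .
    have eq1: "(B' \<inter> S) \<union> (B2 - S) = C"
      using i jB' by (auto simp: B2_def C_def)
    define D where "D = (B2 \<inter> S) \<union> (B' - S)"
    have D: "D \<in> ?MM"
      unfolding D_def by (rule max_meeting_bases_splice[OF val B2 B'])
    have iD: "i \<in> B \<inter> S - D"
      using i jB' by (auto simp: D_def B2_def)
    obtain j' where j': "j' \<in> D \<inter> S - B"
        "\<mu> (insert j' (B - {i})) + \<mu> (insert i (D - {j'})) \<le> \<mu> B + \<mu> D"
      using max_meeting_bases_exchange[OF val less.prems D iD] by metis
    \<comment> \<open>Within \<open>S\<close>, the basis \<open>D\<close> differs from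
      \<open>B\<close> only by having \<open>j\<close> in place of \<open>i\<close>, so the exchange
      partner is forced.\<close>
    have "j' = j"
      using j'(1) by (auto simp: D_def B2_def)
    define F where "F = (B \<inter> S) \<union> (B' - S)"
    have F: "F \<in> ?MM"
      unfolding F_def by (rule max_meeting_bases_splice[OF val less.prems B'])
    have "insert i (D - {j'}) = F"
      using i jB' by (auto simp: D_def B2_def F_def \<open>j' = j\<close>)
    then have le2: "\<mu> B2 + \<mu> F \<le> \<mu> B + \<mu> D"
      using j'(2) by (simp add: \<open>j' = j\<close> B2_def)
    obtain b b' b2 c d f where "\<mu> B = ereal b" "\<mu> B' = ereal b'" "\<mu> B2 = ereal b2" "\<mu> C = ereal c"
        "\<mu> D = ereal d" "\<mu> F = ereal f"
      using real less.prems B' B2 C D F by metis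
    then have "\<mu> C + \<mu> F \<le> \<mu> B + \<mu> B'"
      using le1 le2 unfolding eq1 D_def[symmetric] by simp
    then show ?thesis
      by (simp add: C_def F_def)
  qed
qed

text \<open>Swapping the parts in \<open>S\<close> is an involution on pairs, so the inequality for
  the swapped pair is the reverse inequality.\<close>

lemma max_meeting_bases_splice_eq:
  assumes val: "valuated_matroid E r \<mu>"
    and B: "B \<in> max_meeting_bases (val_bases E r \<mu>) S"
    and B': "B' \<in> max_meeting_bases (val_bases E r \<mu>) S"
  shows "\<mu> ((B' \<inter> S) \<union> (B - S)) + \<mu> ((B \<inter> S) \<union> (B' - S)) = \<mu> B + \<mu> B'"
proof (rule antisym)
  let ?C = "(B' \<inter> S) \<union> (B - S)" and ?F = "(B \<inter> S) \<union> (B' - S)"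
  have "?F \<inter> S \<union> (?C - S) = B" "?C \<inter> S \<union> (?F - S) = B'"
    by auto
  then show "\<mu> B + \<mu> B' \<le> \<mu> ?C + \<mu> ?F"
    using max_meeting_bases_splice_le[OF val max_meeting_bases_splice[OF val B' B]
        max_meeting_bases_splice[OF val B B']] by simp
qed (rule max_meeting_bases_splice_le[OF val B B'])

lemma max_meeting_bases_card:
  assumes "valuated_matroid E r \<mu>" "B \<in> max_meeting_bases (val_bases E r \<mu>) S"
  shows "finite B" "B \<subseteq> E" "card (B \<inter> S) = matroid_rank (val_bases E r \<mu>) S"
    "card (B - S) = r - matroid_rank (val_bases E r \<mu>) S" "matroid_rank (val_bases E r \<mu>) S \<le> r"
proof -
  note b = val_basesD[OF max_meeting_basesD(1)[OF assms(2)]]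
  show "finite B" "B \<subseteq> E"
    using b by auto
  show s: "card (B \<inter> S) = matroid_rank (val_bases E r \<mu>) S"
    using matroid_rank_eq[OF finite_val_bases[OF valuated_matroidD(1)[OF assms(1)]] assms(2)] by simp
  show "card (B - S) = r - matroid_rank (val_bases E r \<mu>) S"
    using b s by (metis card_Diff_subset_Int finite_Int)
  show "matroid_rank (val_bases E r \<mu>) S \<le> r"
    using b s by (metis card_mono inf_le1)
qed

text \<open>This makes the choice in \<open>val_contraction\<close> meaningful. Fix one maximally
  meeting basis \<open>B0\<close>: freezing its part in \<open>S\<close> gives the contraction, and
  freezing its part outside \<open>S\<close> gives the restriction. The splitting of
  \<open>\<mu>\<close> is then \<open>max_meeting_bases_splice_eq\<close>, where the constant
  \<open>- b0\<close> absorbs the extra term \<open>\<mu> B0\<close>.\<close>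

lemma ex_restriction_contraction:
  assumes val: "valuated_matroid E r \<mu>" and S: "S \<subseteq> E"
  shows "\<exists>\<rho> \<kappa>. is_restriction_contraction E r \<mu> S \<rho> \<kappa>"
proof -
  note E = valuated_matroidD(1)[OF val] and \<mu> = valuated_matroidD(2)[OF val]
  let ?\<B> = "val_bases E r \<mu>"
  let ?MM = "max_meeting_bases ?\<B> S"
  define s where "s = matroid_rank ?\<B> S"
  obtain B0 where B0: "B0 \<in> ?MM"
    using max_meeting_bases_nonempty[OF finite_val_bases[OF E] valuated_matroidD(3)[OF val]] by blast
  obtain b0 where b0: "\<mu> B0 = ereal b0"
    using val_bases_real[OF \<mu> max_meeting_basesD(1)[OF B0]] .
  note cards = max_meeting_bases_card[OF val, of _ S, folded s_def]
  define \<kappa> where "\<kappa> = (\<lambda>X\<in>nsets (E - S) (r - s). \<mu> ((B0 \<inter> S) \<union> X))"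
  define \<rho> where "\<rho> = (\<lambda>Y\<in>nsets S s. \<mu> (Y \<union> (B0 - S)) + ereal (- b0))"
  have nX: "(B0 \<inter> S) \<union> X \<in> nsets E r" "((B0 \<inter> S) \<union> X) \<inter> S = B0 \<inter> S" "((B0 \<inter> S) \<union> X) - S = X"
    if "X \<in> nsets (E - S) (r - s)" for X
  proof -
    show "((B0 \<inter> S) \<union> X) \<inter> S = B0 \<inter> S" "((B0 \<inter> S) \<union> X) - S = X"
      using that by (auto simp: nsets_def)
    have "card ((B0 \<inter> S) \<union> X) = s + (r - s)"
      using that cards[OF B0] by (subst card_Un_disjoint) (auto simp: nsets_def)
    then show "(B0 \<inter> S) \<union> X \<in> nsets E r"
      using that cards[OF B0] by (auto simp: nsets_def)
  qed
  have nY: "Y \<union> (B0 - S) \<in> nsets E r" "(Y \<union> (B0 - S)) \<inter> S = Y" "(Y \<union> (B0 - S)) - S = B0 - S"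
    if "Y \<in> nsets S s" for Y
  proof -
    show "(Y \<union> (B0 - S)) \<inter> S = Y" "(Y \<union> (B0 - S)) - S = B0 - S"
      using that by (auto simp: nsets_def)
    have "card (Y \<union> (B0 - S)) = s + (r - s)"
      using that cards[OF B0] by (subst card_Un_disjoint) (auto simp: nsets_def)
    then show "Y \<union> (B0 - S) \<in> nsets E r"
      using that cards[OF B0] S by (auto simp: nsets_def)
  qed
  have "\<kappa> \<in> trop_vec (nsets (E - S) (r - s))"
    using trop_vec_not_MInf[OF \<mu> nX(1)] by (auto simp: trop_vec_def \<kappa>_def)
  moreover have "\<rho> \<in> trop_vec (nsets S s)"
    using trop_vec_not_MInf[OF \<mu> nY(1)] by (auto simp: trop_vec_def \<rho>_def)
  moreover have "val_bases (E - S) (r - s) \<kappa> = contraction_bases ?\<B> S"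
  proof (intro equalityI subsetI)
    fix X assume "X \<in> val_bases (E - S) (r - s) \<kappa>"
    then have X: "X \<in> nsets (E - S) (r - s)" "\<mu> ((B0 \<inter> S) \<union> X) \<noteq> \<infinity>"
      by (auto simp: val_bases_def \<kappa>_def)
    then have "(B0 \<inter> S) \<union> X \<in> ?MM"
      using nX[OF X(1)] by (intro max_meeting_basesI[OF B0]) (auto simp: val_bases_def)
    then show "X \<in> contraction_bases ?\<B> S"
      unfolding contraction_bases_def using nX(3)[OF X(1)] by (metis image_eqI)
  next
    fix X assume "X \<in> contraction_bases ?\<B> S"
    then obtain B where B: "B \<in> ?MM" "X = B - S"
      by (auto simp: contraction_bases_def)
    then have "X \<in> nsets (E - S) (r - s)"
      using cards[OF B(1)] by (auto simp: nsets_def)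
    moreover have "(B0 \<inter> S) \<union> X \<in> ?\<B>"
      using max_meeting_basesD(1)[OF max_meeting_bases_splice[OF val B0 B(1)]] B(2) by simp
    ultimately show "X \<in> val_bases (E - S) (r - s) \<kappa>"
      by (auto simp: val_bases_def \<kappa>_def)
  qed
  moreover have "val_bases S s \<rho> = restriction_bases ?\<B> S"
  proof (intro equalityI subsetI)
    fix Y assume "Y \<in> val_bases S s \<rho>"
    then have Y: "Y \<in> nsets S s" "\<mu> (Y \<union> (B0 - S)) \<noteq> \<infinity>"
      by (auto simp: val_bases_def \<rho>_def)
    moreover have "card Y = card (B0 \<inter> S)"
      using Y cards[OF B0] by (auto simp: nsets_def)
    ultimately have "Y \<union> (B0 - S) \<in> ?MM"
      using nY[OF Y(1)] by (intro max_meeting_basesI[OF B0]) (auto simp: val_bases_def)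
    then show "Y \<in> restriction_bases ?\<B> S"
      unfolding restriction_bases_def using nY(2)[OF Y(1)] by (metis image_eqI)
  next
    fix Y assume "Y \<in> restriction_bases ?\<B> S"
    then obtain B where B: "B \<in> ?MM" "Y = B \<inter> S"
      by (auto simp: restriction_bases_def)
    then have "Y \<in> nsets S s"
      using cards[OF B(1)] by (auto simp: nsets_def)
    moreover have "Y \<union> (B0 - S) \<in> ?\<B>"
      using max_meeting_basesD(1)[OF max_meeting_bases_splice[OF val B(1) B0]] B(2) by simp
    ultimately show "Y \<in> val_bases S s \<rho>"
      by (auto simp: val_bases_def \<rho>_def)
  qed
  moreover have "\<mu> B = \<rho> (B \<inter> S) + \<kappa> (B - S)" if B: "B \<in> ?MM" for B
  proof -
    have "B \<inter> S \<in> nsets S s" "B - S \<in> nsets (E - S) (r - s)"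
      using cards[OF B] by (auto simp: nsets_def)
    then have "\<rho> (B \<inter> S) = \<mu> ((B \<inter> S) \<union> (B0 - S)) + ereal (- b0)" "\<kappa> (B - S) = \<mu> ((B0 \<inter> S) \<union> (B - S))"
      by (simp_all add: \<rho>_def \<kappa>_def)
    moreover have "\<mu> ((B0 \<inter> S) \<union> (B - S)) + \<mu> ((B \<inter> S) \<union> (B0 - S)) = \<mu> B + \<mu> B0"
      by (rule max_meeting_bases_splice_eq[OF val B B0])
    moreover obtain x y z where "\<mu> B = ereal x" "\<mu> ((B0 \<inter> S) \<union> (B - S)) = ereal y"
        "\<mu> ((B \<inter> S) \<union> (B0 - S)) = ereal z"
      using val_bases_real[OF \<mu>] max_meeting_basesD(1)[OF B]
        max_meeting_basesD(1)[OF max_meeting_bases_splice[OF val B B0]]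
        max_meeting_basesD(1)[OF max_meeting_bases_splice[OF val B0 B]] by metis
    ultimately show ?thesis
      using b0 by simp
  qed
  ultimately have "is_restriction_contraction E r \<mu> S \<rho> \<kappa>"
    unfolding is_restriction_contraction_def Let_def s_def by blast
  then show ?thesis
    by blast
qed

lemma val_contraction_restriction:
  assumes "valuated_matroid E r \<mu>" "S \<subseteq> E"
  obtains \<rho> where "is_restriction_contraction E r \<mu> S \<rho> (val_contraction E r \<mu> S)"
  using someI_ex[of "\<lambda>\<kappa>. \<exists>\<rho>. is_restriction_contraction E r \<mu> S \<rho> \<kappa>"] ex_restriction_contraction[OF assms]
  unfolding val_contraction_def by blast

text \<open>Matches the part of \<open>L(\<mu>)\<close> with infinite set \<open>S\<close> with the
  finite vectors for the contraction. From right to left, a set \<open>T\<close> is enlarged by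
  \<open>A\<close>, the part in \<open>S\<close> of a maximally meeting basis, and the entries at
  \<open>A\<close> are infinite. From left to right, initial bases of the contraction enlarged by
  \<open>A\<close> provide the cocircuit vectors of \<open>\<mu>\<close> whose minimum is
  \<open>u\<close>.\<close>

lemma trop_orthogonal_contraction_iff:
  fixes E r \<mu> S
  defines "k \<equiv> r - matroid_rank (val_bases E r \<mu>) S"
  assumes val: "valuated_matroid E r \<mu>" and S: "S \<subseteq> E"
    and rc: "is_restriction_contraction E r \<mu> S \<rho> \<kappa>"
    and uS: "\<And>i. i \<in> S \<Longrightarrow> u i = \<infinity>" and uE: "\<And>i. i \<in> E - S \<Longrightarrow> \<bar>u i\<bar> \<noteq> \<infinity>"
  shows "trop_orthogonal (E - S) k \<kappa> u \<longleftrightarrow> trop_orthogonal E r \<mu> u"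
proof -
  note E = valuated_matroidD(1)[OF val] and \<mu> = valuated_matroidD(2)[OF val]
  let ?\<B> = "val_bases E r \<mu>"
  let ?MM = "max_meeting_bases ?\<B> S"
  define s where "s = matroid_rank ?\<B> S"
  have ks: "k = r - s"
    by (simp add: k_def s_def)
  note cards = max_meeting_bases_card[OF val, of _ S, folded s_def]
  have \<rho>: "\<rho> \<in> trop_vec (nsets S s)" "val_bases S s \<rho> = restriction_bases ?\<B> S"
    and \<kappa>: "\<kappa> \<in> trop_vec (nsets (E - S) k)" "val_bases (E - S) k \<kappa> = contraction_bases ?\<B> S"
    and split: "\<And>B. B \<in> ?MM \<Longrightarrow> \<mu> B = \<rho> (B \<inter> S) + \<kappa> (B - S)"
    using rc unfolding is_restriction_contraction_def Let_def s_def k_def by auto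
  obtain B0 where B0: "B0 \<in> ?MM"
    using max_meeting_bases_nonempty[OF finite_val_bases[OF E] valuated_matroidD(3)[OF val]] by blast
  define A where "A = B0 \<inter> S"
  have A: "A \<subseteq> S" "finite A" "card A = s" and sr: "s \<le> r"
    using cards[OF B0] by (auto simp: A_def)
  have "A \<in> val_bases S s \<rho>"
    using B0 by (auto simp: \<rho>(2) restriction_bases_def A_def)
  then obtain a where a: "\<rho> A = ereal a"
    using val_bases_real[OF \<rho>(1)] by blast
  \<comment> \<open>Adjoining \<open>A\<close> identifies \<open>\<kappa>\<close> with
    \<open>\<mu>\<close> up to the constant \<open>a\<close>, infinite values included.\<close>
  have \<mu>_un: "\<mu> (X \<union> A) = \<kappa> X + ereal a" if X: "X \<in> nsets (E - S) k" for X
  proof -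
    have XS: "(X \<union> A) \<inter> S = A" "(X \<union> A) - S = X"
      using X A by (auto simp: nsets_def)
    have "card (X \<union> A) = k + s"
      using X A by (subst card_Un_disjoint) (auto simp: nsets_def)
    then have n: "X \<union> A \<in> nsets E r"
      using X A sr S by (auto simp: nsets_def ks)
    show ?thesis
    proof (cases "X \<union> A \<in> ?\<B>")
      case True
      then have "X \<union> A \<in> ?MM"
        using XS by (intro max_meeting_basesI[OF B0]) (simp_all add: A_def)
      then show ?thesis
        using split XS a by (metis add.commute)
    next
      case False
      have "X \<notin> contraction_bases ?\<B> S"
      proof
        assume "X \<in> contraction_bases ?\<B> S"
        then obtain B where "B \<in> ?MM" "X = B - S"
          by (auto simp: contraction_bases_def)
        then have "X \<union> A \<in> ?MM"
          using max_meeting_bases_splice[OF val B0] by (simp add: A_def Un_commute)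
        then show False
          using False max_meeting_basesD(1) by blast
      qed
      then have "X \<notin> val_bases (E - S) k \<kappa>"
        unfolding \<kappa>(2) .
      then have "\<kappa> X = \<infinity>"
        using X by (simp add: val_bases_def)
      then show ?thesis
        using False n by (simp add: val_bases_def)
    qed
  qed
  show ?thesis
  proof
    assume orth: "trop_orthogonal E r \<mu> u"
    show "trop_orthogonal (E - S) k \<kappa> u"
      unfolding trop_orthogonal_def
    proof (intro ballI impI)
      fix T i assume T: "T \<in> nsets (E - S) (k + 1)" and i: "i \<in> T" and fin: "\<kappa> (T - {i}) + u i \<noteq> \<infinity>"
      have TE: "T \<subseteq> E - S"
        using T by (simp add: nsets_def)
      have "card (T \<union> A) = k + 1 + s"
        using T A by (subst card_Un_disjoint) (auto simp: nsets_def)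
      then have TA: "T \<union> A \<in> nsets E (r + 1)"
        using T A sr S by (auto simp: nsets_def ks)
      have \<mu>_remove: "\<mu> (T \<union> A - {j}) = \<kappa> (T - {j}) + ereal a" if "j \<in> T" for j
      proof -
        have "T \<union> A - {j} = (T - {j}) \<union> A"
          using that A TE by auto
        then show ?thesis
          using \<mu>_un[OF nsets_remove[OF T that]] by simp
      qed
      have u_real: "\<exists>x. u j = ereal x" if "j \<in> T" for j
        using uE[of j] that TE by (cases "u j") auto
      obtain x where x: "u i = ereal x"
        using u_real[OF i] by blast
      have \<kappa>i: "\<kappa> (T - {i}) \<noteq> \<infinity>"
        using fin x by auto
      then obtain y where y: "\<kappa> (T - {i}) = ereal y"
        using trop_vec_not_MInf[OF \<kappa>(1) nsets_remove[OF T i]] by (cases "\<kappa> (T - {i})") auto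
      have fin': "\<mu> (T \<union> A - {i}) + u i \<noteq> \<infinity>"
        using \<mu>_remove[OF i] x y by simp
      have "i \<in> T \<union> A"
        using i by blast
      then obtain j where j: "j \<in> T \<union> A" "j \<noteq> i" "\<mu> (T \<union> A - {j}) + u j \<le> \<mu> (T \<union> A - {i}) + u i"
        using orth TA fin' unfolding trop_orthogonal_def by blast
      have "j \<in> T"
      proof (rule ccontr)
        assume "j \<notin> T"
        then have "u j = \<infinity>"
          using j A uS by auto
        then show False
          using j(3) fin' by simp
      qed
      moreover obtain z where z: "u j = ereal z"
        using u_real[OF \<open>j \<in> T\<close>] by blast
      moreover have "\<kappa> (T - {j}) + u j \<le> \<kappa> (T - {i}) + u i"
        using j(3) unfolding \<mu>_remove[OF i] \<mu>_remove[OF \<open>j \<in> T\<close>] x y z by (cases "\<kappa> (T - {j})") auto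
      ultimately show "\<exists>j\<in>T. j \<noteq> i \<and> \<kappa> (T - {j}) + u j \<le> \<kappa> (T - {i}) + u i"
        using j(2) by blast
    qed
  next
    assume orth: "trop_orthogonal (E - S) k \<kappa> u"
    show "trop_orthogonal E r \<mu> u"
    proof (rule trop_orthogonal_if_min_of_cocircuits[OF val])
      show "u j \<noteq> -\<infinity>" if "j \<in> E" for j
        using uS[of j] uE[of j] that by (cases "j \<in> S") auto
      fix i assume iE: "i \<in> E" and ui: "u i \<noteq> \<infinity>"
      then have iES: "i \<in> E - S"
        using uS by auto
      define w where "w j = - real_of_ereal (u j)" for j
      have w: "u j = ereal (- w j)" if "j \<in> E - S" for j
        using uE[OF that] by (auto simp: w_def ereal_real')
      have ne: "val_bases (E - S) k \<kappa> \<noteq> {}"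
        using B0 by (auto simp: \<kappa>(2) contraction_bases_def)
      obtain B where B: "B \<in> initial_bases (E - S) k \<kappa> w" "i \<in> B"
      proof (rule trop_orthogonal_imp_initial_basis[OF _ \<kappa>(1) ne _ orth _ iES ui])
        show "finite (E - S)"
          using E by simp
        show "u j \<noteq> -\<infinity>" if "j \<in> E - S" for j
          using uE[OF that] by auto
        show "u j = ereal (- w j)" if "j \<in> E - S" for j
          using w[OF that] .
      qed
      have Bb: "B \<in> val_bases (E - S) k \<kappa>"
        using B by (simp add: initial_bases_def)
      then have nB: "B \<in> nsets (E - S) k"
        by (simp add: val_bases_def)
      obtain x where x: "\<kappa> B = ereal x"
        using val_bases_real[OF \<kappa>(1) Bb] .
      have BAr: "\<mu> (B \<union> A) = ereal (x + a)"
        using \<mu>_un[OF nB] x by simp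
      have "card (B \<union> A) = k + s"
        using nB A by (subst card_Un_disjoint) (auto simp: nsets_def)
      then have nBA: "B \<union> A \<in> nsets E r"
        using nB A S sr by (auto simp: nsets_def ks)
      have BA: "B \<union> A \<in> ?\<B>"
        using nBA BAr by (simp add: val_bases_def)
      have BE: "B \<subseteq> E - S" "finite B"
        using nB by (auto simp: nsets_def)
      have "u j + \<mu> (B \<union> A) \<le> \<mu> (insert j (B \<union> A - {i})) + u i" if j: "j \<in> E - (B \<union> A)" for j
      proof (cases "j \<in> S")
        case True
        \<comment> \<open>Here \<open>u j\<close> is infinite, so the cocircuit entry must be
          infinite too. The exchanged set meets \<open>S\<close> in too many elements to be a
          basis.\<close>
        have "insert j (B \<union> A - {i}) \<inter> S = insert j A"
          using True A BE iES by auto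
        then have "card (insert j (B \<union> A - {i}) \<inter> S) = card (B0 \<inter> S) + 1"
          using j A by (simp add: A_def)
        then have "insert j (B \<union> A - {i}) \<notin> ?\<B>"
          using max_meeting_basesD(2)[OF B0, of "insert j (B \<union> A - {i})"] by auto
        moreover have "insert j (B \<union> A - {i}) \<in> nsets E r"
          using nBA j B by (intro nsets_exchange) auto
        ultimately show ?thesis
          using w[OF iES] by (simp add: val_bases_def)
      next
        case False
        then have jES: "j \<in> E - S"
          using j by blast
        have n: "insert j (B - {i}) \<in> nsets (E - S) k"
          using nB j B jES by (intro nsets_exchange) auto
        have "insert j (B \<union> A - {i}) = insert j (B - {i}) \<union> A"
          using A iES by auto
        then have m: "\<mu> (insert j (B \<union> A - {i})) = \<kappa> (insert j (B - {i})) + ereal a"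
          using \<mu>_un[OF n] by simp
        show ?thesis
        proof (cases "\<kappa> (insert j (B - {i})) = \<infinity>")
          case True
          then show ?thesis
            using m w[OF iES] by simp
        next
          case False
          then have b: "insert j (B - {i}) \<in> val_bases (E - S) k \<kappa>"
            using n by (simp add: val_bases_def)
          then obtain y where y: "\<kappa> (insert j (B - {i})) = ereal y"
            using val_bases_real[OF \<kappa>(1)] by blast
          have "\<kappa> B + ereal (sum w B) \<le> \<kappa> (insert j (B - {i})) + ereal (sum w (insert j (B - {i})))"
            using B b by (simp add: initial_bases_def)
          moreover have "sum w (insert j (B - {i})) = sum w B - w i + w j"
            using j B BE by (intro sum_exchange) auto
          ultimately have "x \<le> y - w i + w j"
            using x y by simp
          then show ?thesis
            unfolding m y BAr w[OF iES] w[OF jES] by simp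
        qed
      qed
      then show "\<exists>B\<in>?\<B>. i \<in> B \<and> (\<forall>j\<in>E - B. u j + \<mu> B \<le> \<mu> (insert j (B - {i})) + u i)"
        using BA B(2) by (intro bexI[of _ "B \<union> A"]) auto
    qed
  qed
qed

section \<open>Projective classes and tropical linear spaces\<close>

lemma proj_class_self: "u \<in> trop_vec E - {infty_vec E} \<Longrightarrow> u \<in> proj_class E u"
  by (auto simp: proj_class_def proj_rel_def intro: exI[of _ 0])

lemma mem_proj_classD:
  assumes "v \<in> proj_class E u"
  obtains c where "\<And>i. i \<in> E \<Longrightarrow> v i = u i + ereal c"
  using assms by (auto simp: proj_class_def proj_rel_def)

lemma ereal_add_le_cancel: "x + ereal c \<le> y + ereal c \<longleftrightarrow> x \<le> y"
  by (cases x; cases y) auto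

lemma ereal_add_eq_PInf: "x + ereal c = \<infinity> \<longleftrightarrow> x = \<infinity>"
  by (cases x) auto

lemma trop_orthogonal_shift:
  assumes "trop_orthogonal E r \<mu> u" "\<And>i. i \<in> E \<Longrightarrow> v i = u i + ereal c"
  shows "trop_orthogonal E r \<mu> v"
  unfolding trop_orthogonal_def
proof (intro ballI impI)
  fix S i assume S: "S \<in> nsets E (r + 1)" and i: "i \<in> S" and fin: "\<mu> (S - {i}) + v i \<noteq> \<infinity>"
  have v: "\<mu> (S - {j}) + v j = \<mu> (S - {j}) + u j + ereal c" if "j \<in> S" for j
    using assms(2)[of j] that S by (auto simp: nsets_def add.assoc)
  have "\<mu> (S - {i}) + u i \<noteq> \<infinity>"
    using fin v[OF i] by auto
  then obtain j where "j \<in> S" "j \<noteq> i" "\<mu> (S - {j}) + u j \<le> \<mu> (S - {i}) + u i"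
    using assms(1) S i unfolding trop_orthogonal_def by blast
  then show "\<exists>j\<in>S. j \<noteq> i \<and> \<mu> (S - {j}) + v j \<le> \<mu> (S - {i}) + v i"
    using v i by (intro bexI[of _ j]) (simp_all add: ereal_add_le_cancel)
qed

lemma trop_orthogonal_shift_iff:
  assumes "\<And>i. i \<in> E \<Longrightarrow> v i = u i + ereal c"
  shows "trop_orthogonal E r \<mu> v \<longleftrightarrow> trop_orthogonal E r \<mu> u"
proof -
  have "u i = v i + ereal (- c)" if "i \<in> E" for i
    unfolding assms[OF that] by (cases "u i") auto
  then show ?thesis
    using trop_orthogonal_shift assms by metis
qed

lemma trop_orthogonal_cong: "(\<And>i. i \<in> E \<Longrightarrow> u i = v i) \<Longrightarrow> trop_orthogonal E r \<mu> u = trop_orthogonal E r \<mu> v"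
  by (rule trop_orthogonal_shift_iff[of _ _ _ 0]) simp

text \<open>For real-valued \<open>u\<close> an entry is infinite exactly when the circuit
  coordinate is. Neither the restriction to finite circuit coordinates nor the exclusion of the
  all-infinite vector therefore changes the condition.\<close>

lemma valuated_circuits_iff_trop_orthogonal:
  assumes E: "finite E" and u: "u \<in> E \<rightarrow>\<^sub>E range ereal"
  shows "(\<forall>C\<in>valuated_circuits E r \<mu>. min_attained_twice {# C i + u i. i \<in># mset_set {i\<in>E. C i \<noteq> \<infinity>} #})
    \<longleftrightarrow> trop_orthogonal E r \<mu> u"
proof -
  have ur: "\<exists>x. u i = ereal x" if "i \<in> E" for i
    using PiE_mem[OF u that] by blast
  have add_inf: "x + u i = \<infinity> \<longleftrightarrow> x = \<infinity>" if "i \<in> E" for i x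
    using ur[OF that] by (auto simp: ereal_add_eq_PInf)
  have fin: "finite {i\<in>E. C i \<noteq> \<infinity>}" for C :: "'a \<Rightarrow> ereal"
    using E by simp
  show ?thesis
    unfolding min_attained_twice_image_iff[OF fin]
  proof (intro iffI ballI)
    assume L: "\<forall>C\<in>valuated_circuits E r \<mu>. \<forall>i\<in>{i\<in>E. C i \<noteq> \<infinity>}. C i + u i \<noteq> \<infinity> \<longrightarrow>
      (\<exists>j\<in>{i\<in>E. C i \<noteq> \<infinity>}. j \<noteq> i \<and> C j + u j \<le> C i + u i)"
    show "trop_orthogonal E r \<mu> u"
      unfolding trop_orthogonal_def
    proof (intro ballI impI)
      fix S i assume S: "S \<in> nsets E (r + 1)" and i: "i \<in> S" and f: "\<mu> (S - {i}) + u i \<noteq> \<infinity>"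
      let ?C = "valuated_circuit E \<mu> S"
      have SE: "S \<subseteq> E"
        using S by (simp add: nsets_def)
      have C: "?C j = \<mu> (S - {j})" if "j \<in> S" for j
        using that SE by (auto simp: valuated_circuit_def)
      have iE: "i \<in> E"
        using i SE by auto
      have Ci: "?C i \<noteq> \<infinity>"
        using f C[OF i] add_inf[OF iE] by simp
      then have "?C \<noteq> infty_vec E"
        using iE by (auto simp: infty_vec_def)
      then have "?C \<in> valuated_circuits E r \<mu>"
        using S by (simp add: valuated_circuits_def)
      moreover have "i \<in> {i\<in>E. ?C i \<noteq> \<infinity>}"
        using iE Ci by simp
      moreover have "?C i + u i \<noteq> \<infinity>"
        using f C[OF i] by simp
      ultimately obtain j where j: "j \<in> E" "?C j \<noteq> \<infinity>" "j \<noteq> i" "?C j + u j \<le> ?C i + u i"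
        using L by blast
      then have "j \<in> S"
        by (auto simp: valuated_circuit_def split: if_splits)
      then show "\<exists>j\<in>S. j \<noteq> i \<and> \<mu> (S - {j}) + u j \<le> \<mu> (S - {i}) + u i"
        using j C[OF i] C by (intro bexI[of _ j]) auto
    qed
  next
    fix C i assume orth: "trop_orthogonal E r \<mu> u" and C: "C \<in> valuated_circuits E r \<mu>"
      and i: "i \<in> {i\<in>E. C i \<noteq> \<infinity>}"
    obtain S where S: "S \<in> nsets E (r + 1)" "C = valuated_circuit E \<mu> S"
      using C by (auto simp: valuated_circuits_def)
    have SE: "S \<subseteq> E"
      using S by (simp add: nsets_def)
    have Cj: "C j = \<mu> (S - {j})" if "j \<in> S" for j
      using that SE S by (auto simp: valuated_circuit_def)
    have iS: "i \<in> S"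
      using i S by (auto simp: valuated_circuit_def split: if_splits)
    show "C i + u i \<noteq> \<infinity> \<longrightarrow> (\<exists>j\<in>{i\<in>E. C i \<noteq> \<infinity>}. j \<noteq> i \<and> C j + u j \<le> C i + u i)"
    proof
      assume f: "C i + u i \<noteq> \<infinity>"
      then obtain j where j: "j \<in> S" "j \<noteq> i" "\<mu> (S - {j}) + u j \<le> \<mu> (S - {i}) + u i"
        using orth S(1) iS Cj[OF iS] unfolding trop_orthogonal_def by metis
      have jE: "j \<in> E"
        using j SE by blast
      have le: "C j + u j \<le> C i + u i"
        using j Cj iS by simp
      then have "C j + u j \<noteq> \<infinity>"
        using f by auto
      then have "C j \<noteq> \<infinity>"
        using add_inf[OF jE] by simp
      then show "\<exists>j\<in>{i\<in>E. C i \<noteq> \<infinity>}. j \<noteq> i \<and> C j + u j \<le> C i + u i"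
        using j le jE by (intro bexI[of _ j]) auto
    qed
  qed
qed

lemma trop_linear_space_eq:
  assumes "finite E"
  shows "trop_linear_space E r \<mu> =
    {proj_class E u | u. u \<in> E \<rightarrow>\<^sub>E range ereal \<and> trop_orthogonal E r \<mu> u}"
  unfolding trop_linear_space_def
  by (intro Collect_cong ex_cong1 conj_cong refl valuated_circuits_iff_trop_orthogonal[OF assms])

text \<open>The union over contractions collapses to one condition on vectors with infinite
  coordinates. A vector belongs to the stratum of its set \<open>S\<close> of infinite coordinates,
  where \<open>trop_orthogonal_contraction_iff\<close> applies, and properness of \<open>S\<close>
  means that the vector is not all infinite.\<close>

lemma proj_trop_linear_space_eq:
  assumes val: "valuated_matroid E r \<mu>"
  shows "proj_trop_linear_space E r \<mu> =
    {proj_class E u | u. u \<in> trop_vec E - {infty_vec E} \<and> trop_orthogonal E r \<mu> u}"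
proof (intro equalityI subsetI)
  note E = valuated_matroidD(1)[OF val]
  fix P assume "P \<in> proj_trop_linear_space E r \<mu>"
  then obtain S u where S: "S \<subset> E" and u: "u \<in> trop_vec (E - S)"
    and P: "P = proj_class E (\<lambda>i\<in>E. if i \<in> S then \<infinity> else u i)"
    and mem: "proj_class (E - S) u \<in> trop_linear_space (E - S)
      (r - matroid_rank (val_bases E r \<mu>) S) (val_contraction E r \<mu> S)"
    by (auto simp: proj_trop_linear_space_def times_infty_def)
  let ?k = "r - matroid_rank (val_bases E r \<mu>) S" and ?\<kappa> = "val_contraction E r \<mu> S"
  define \<uu> where "\<uu> = (\<lambda>i\<in>E. if i \<in> S then \<infinity> else u i)"
  have SE: "S \<subseteq> E"
    using S by blast
  obtain v where v: "v \<in> (E - S) \<rightarrow>\<^sub>E range ereal" "proj_class (E - S) u = proj_class (E - S) v"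
    and orth: "trop_orthogonal (E - S) ?k ?\<kappa> v"
    using mem unfolding trop_linear_space_eq[OF finite_Diff[OF E]] by blast
  \<comment> \<open>An element outside \<open>S\<close> shows that \<open>v\<close> is not all
    infinite, so \<open>v\<close> lies in its own class. As \<open>v\<close> is then a translate of
    \<open>u\<close>, the vector \<open>u\<close> is finite on \<open>E - S\<close>.\<close>
  obtain e where e: "e \<in> E - S"
    using S by blast
  have "v e \<noteq> \<infinity>"
    using v(1) e by auto
  then have "v \<in> trop_vec (E - S) - {infty_vec (E - S)}"
    using v(1) e by (auto simp: trop_vec_def infty_vec_def)
  then have "v \<in> proj_class (E - S) u"
    using proj_class_self v(2) by metis
  then obtain c where c: "\<And>i. i \<in> E - S \<Longrightarrow> v i = u i + ereal c"
    using mem_proj_classD by metis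
  have real: "\<bar>u i\<bar> \<noteq> \<infinity>" if "i \<in> E - S" for i
    using c[OF that] v(1) that by (cases "u i") auto
  have "trop_orthogonal (E - S) ?k ?\<kappa> \<uu> \<longleftrightarrow> trop_orthogonal (E - S) ?k ?\<kappa> u"
    by (rule trop_orthogonal_cong) (auto simp: \<uu>_def)
  also have "\<dots> \<longleftrightarrow> trop_orthogonal (E - S) ?k ?\<kappa> v"
    by (rule trop_orthogonal_shift_iff[OF c, symmetric])
  finally have "trop_orthogonal (E - S) ?k ?\<kappa> \<uu>"
    using orth by simp
  moreover obtain \<rho> where "is_restriction_contraction E r \<mu> S \<rho> ?\<kappa>"
    using val_contraction_restriction[OF val SE] .
  moreover have "\<uu> i = \<infinity>" if "i \<in> S" for i
    using that SE by (auto simp: \<uu>_def)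
  moreover have "\<bar>\<uu> i\<bar> \<noteq> \<infinity>" if "i \<in> E - S" for i
    using that real by (simp add: \<uu>_def)
  ultimately have "trop_orthogonal E r \<mu> \<uu>"
    using trop_orthogonal_contraction_iff[OF val SE, of \<rho> ?\<kappa> \<uu>] by blast
  moreover have "\<uu> \<in> trop_vec E"
    using trop_vec_not_MInf[OF u] by (auto simp: \<uu>_def trop_vec_def split: if_splits)
  moreover have "\<uu> \<noteq> infty_vec E"
  proof
    assume "\<uu> = infty_vec E"
    then have "\<uu> e = \<infinity>"
      using e by (simp add: infty_vec_def)
    then show False
      using e real[OF e] by (simp add: \<uu>_def)
  qed
  ultimately show "P \<in> {proj_class E u | u. u \<in> trop_vec E - {infty_vec E} \<and> trop_orthogonal E r \<mu> u}"
    using P by (auto simp: \<uu>_def[symmetric])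
next
  note E = valuated_matroidD(1)[OF val]
  fix P assume "P \<in> {proj_class E u | u. u \<in> trop_vec E - {infty_vec E} \<and> trop_orthogonal E r \<mu> u}"
  then obtain u where P: "P = proj_class E u" and u: "u \<in> trop_vec E" "u \<noteq> infty_vec E"
    and orth: "trop_orthogonal E r \<mu> u"
    by auto
  define S where "S = {i\<in>E. u i = \<infinity>}"
  have SE: "S \<subseteq> E"
    by (auto simp: S_def)
  have "S \<noteq> E"
  proof
    assume "S = E"
    then have "u i = infty_vec E i" for i
      using u(1) by (cases "i \<in> E") (auto simp: S_def infty_vec_def trop_vec_def)
    then show False
      using u(2) by blast
  qed
  let ?k = "r - matroid_rank (val_bases E r \<mu>) S" and ?\<kappa> = "val_contraction E r \<mu> S"
  define v where "v = restrict u (E - S)"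
  have real: "\<exists>x. u i = ereal x" if "i \<in> E - S" for i
    using u(1) that by (cases "u i") (auto simp: trop_vec_def S_def)
  have v: "v \<in> (E - S) \<rightarrow>\<^sub>E range ereal"
    unfolding v_def restrict_PiE_iff using real by blast
  obtain \<rho> where "is_restriction_contraction E r \<mu> S \<rho> ?\<kappa>"
    using val_contraction_restriction[OF val SE] .
  moreover have "\<bar>u i\<bar> \<noteq> \<infinity>" if "i \<in> E - S" for i
    using real[OF that] by auto
  moreover have "u i = \<infinity>" if "i \<in> S" for i
    using that by (simp add: S_def)
  ultimately have "trop_orthogonal (E - S) ?k ?\<kappa> u"
    using trop_orthogonal_contraction_iff[OF val SE, of \<rho> ?\<kappa> u] orth by blast
  then have "trop_orthogonal (E - S) ?k ?\<kappa> v"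
    using trop_orthogonal_cong[of "E - S" u v] by (auto simp: v_def)
  then have "proj_class (E - S) v \<in> trop_linear_space (E - S) ?k ?\<kappa>"
    using v unfolding trop_linear_space_eq[OF finite_Diff[OF E]] by blast
  moreover have "v \<in> trop_vec (E - S)"
    using v by (auto simp: trop_vec_def)
  moreover have "u = (\<lambda>i\<in>E. if i \<in> S then \<infinity> else v i)"
    using u(1) by (auto simp: fun_eq_iff S_def v_def trop_vec_def PiE_def extensional_def)
  ultimately have "P \<in> times_infty E S (trop_linear_space (E - S) ?k ?\<kappa>)"
    unfolding P times_infty_def by blast
  then show "P \<in> proj_trop_linear_space E r \<mu>"
    using SE \<open>S \<noteq> E\<close> unfolding proj_trop_linear_space_def by blast
qed

lemma proj_class_mem_proj_trop_linear_space_iff: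
  assumes val: "valuated_matroid E r \<mu>" and u: "u \<in> trop_vec E - {infty_vec E}"
  shows "proj_class E u \<in> proj_trop_linear_space E r \<mu> \<longleftrightarrow> trop_orthogonal E r \<mu> u"
proof
  assume "proj_class E u \<in> proj_trop_linear_space E r \<mu>"
  then obtain v where v: "proj_class E v = proj_class E u" "trop_orthogonal E r \<mu> v"
    using proj_trop_linear_space_eq[OF val] by auto
  then have "u \<in> proj_class E v"
    using proj_class_self[OF u] by simp
  then show "trop_orthogonal E r \<mu> u"
    using trop_orthogonal_shift[OF v(2)] mem_proj_classD by metis
qed (use proj_trop_linear_space_eq[OF val] u in blast)

lemma proj_trop_linear_space_mono:
  assumes "valuated_matroid E r \<mu>" "valuated_matroid E s \<nu>"
    and "\<And>w. matroid_quotient E (initial_bases E r \<mu> w) (initial_bases E s \<nu> w)"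
  shows "proj_trop_linear_space E r \<mu> \<subseteq> proj_trop_linear_space E s \<nu>"
proof
  fix P assume "P \<in> proj_trop_linear_space E r \<mu>"
  then obtain u where u: "P = proj_class E u" "u \<in> trop_vec E - {infty_vec E}" "trop_orthogonal E r \<mu> u"
    using proj_trop_linear_space_eq[OF assms(1)] by auto
  then have "trop_orthogonal E s \<nu> u"
    using trop_orthogonal_mono_if_initial_quotients[OF assms, of u] trop_vec_not_MInf[of u E] by blast
  then show "P \<in> proj_trop_linear_space E s \<nu>"
    using proj_class_mem_proj_trop_linear_space_iff[OF assms(2)] u by blast
qed

section \<open>Cocircuit vectors\<close>

text \<open>The intended \<open>I\<close> has one element fewer than a basis. For
  \<open>j \<in> I\<close> the set \<open>insert j I\<close> is \<open>I\<close> itself, which lies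
  outside the domain of \<open>\<mu>\<close>, so infinity is put there explicitly.\<close>

definition valuated_cocircuit :: "'a set \<Rightarrow> ('a set \<Rightarrow> ereal) \<Rightarrow> 'a set \<Rightarrow> 'a \<Rightarrow> ereal"
  where "valuated_cocircuit E \<mu> I = (\<lambda>j\<in>E. if j \<in> I then \<infinity> else \<mu> (insert j I))"

text \<open>Indices in \<open>I\<close> contribute infinite entries, which neither demand a rival
  nor can serve as one for a finite entry. What remains is the incidence relation on
  \<open>J - I\<close>.\<close>

lemma valuated_cocircuit_trop_orthogonal_iff:
  "trop_orthogonal E s \<nu> (valuated_cocircuit E \<mu> I) \<longleftrightarrow>
    (\<forall>J\<in>nsets E (s + 1). \<forall>i\<in>J - I. \<mu> (insert i I) + \<nu> (J - {i}) \<noteq> \<infinity> \<longrightarrow>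
      (\<exists>j\<in>J - I. j \<noteq> i \<and> \<mu> (insert j I) + \<nu> (J - {j}) \<le> \<mu> (insert i I) + \<nu> (J - {i})))"
proof -
  let ?v = "valuated_cocircuit E \<mu> I"
  have v: "\<nu> (J - {j}) + ?v j = (if j \<in> I then \<infinity> else \<mu> (insert j I) + \<nu> (J - {j}))"
    if J: "J \<in> nsets E (s + 1)" and j: "j \<in> J" for J j
  proof -
    have "j \<in> E"
      using J j by (auto simp: nsets_def)
    then show ?thesis
      by (simp add: valuated_cocircuit_def add.commute)
  qed
  show ?thesis
    unfolding trop_orthogonal_def
  proof (rule ball_cong[OF refl])
    fix J assume J: "J \<in> nsets E (s + 1)"
    let ?f = "\<lambda>j. \<mu> (insert j I) + \<nu> (J - {j})"
    have "(\<exists>j\<in>J. j \<noteq> i \<and> \<nu> (J - {j}) + ?v j \<le> ?f i) \<longleftrightarrow> (\<exists>j\<in>J - I. j \<noteq> i \<and> ?f j \<le> ?f i)"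
      if "?f i \<noteq> \<infinity>" for i
      using that by (auto simp: v[OF J])
    then show "(\<forall>i\<in>J. \<nu> (J - {i}) + ?v i \<noteq> \<infinity> \<longrightarrow>
          (\<exists>j\<in>J. j \<noteq> i \<and> \<nu> (J - {j}) + ?v j \<le> \<nu> (J - {i}) + ?v i)) \<longleftrightarrow>
        (\<forall>i\<in>J - I. ?f i \<noteq> \<infinity> \<longrightarrow> (\<exists>j\<in>J - I. j \<noteq> i \<and> ?f j \<le> ?f i))"
      by (auto simp: v[OF J])
  qed
qed

lemma incidence_pluecker_iff_valuated_cocircuits:
  assumes "finite E"
  shows "incidence_pluecker E r \<mu> s \<nu> \<longleftrightarrow>
    (\<forall>I\<subseteq>E. card I + 1 = r \<longrightarrow> trop_orthogonal E s \<nu> (valuated_cocircuit E \<mu> I))"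
proof -
  define Q where "Q I J \<longleftrightarrow> (\<forall>i\<in>J - I. \<mu> (insert i I) + \<nu> (J - {i}) \<noteq> \<infinity> \<longrightarrow>
    (\<exists>j\<in>J - I. j \<noteq> i \<and> \<mu> (insert j I) + \<nu> (J - {j}) \<le> \<mu> (insert i I) + \<nu> (J - {i})))" for I J
  have "incidence_pluecker E r \<mu> s \<nu> \<longleftrightarrow> (\<forall>I\<subseteq>E. \<forall>J\<in>nsets E (s + 1). card I + 1 = r \<longrightarrow> Q I J)"
    unfolding Q_def by (rule incidence_pluecker_iff[OF assms])
  moreover have "trop_orthogonal E s \<nu> (valuated_cocircuit E \<mu> I) \<longleftrightarrow> (\<forall>J\<in>nsets E (s + 1). Q I J)" for I
    unfolding Q_def by (rule valuated_cocircuit_trop_orthogonal_iff)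
  ultimately show ?thesis
    by blast
qed

text \<open>The incidence relations of \<open>\<mu>\<close> with itself put its cocircuit vectors
  into \<open>L(\<mu>)\<close>. The inclusion carries them into \<open>L(\<nu>)\<close>, and this is
  the incidence relation for the pair.\<close>

lemma valuated_quotient_if_proj_trop_linear_space_mono:
  assumes \<mu>: "valuated_matroid E r \<mu>" and \<nu>: "valuated_matroid E s \<nu>"
    and sub: "proj_trop_linear_space E r \<mu> \<subseteq> proj_trop_linear_space E s \<nu>"
  shows "valuated_quotient E r \<mu> s \<nu>"
proof -
  note E = valuated_matroidD(1)[OF \<mu>]
  note inc_iff = incidence_pluecker_iff_valuated_quotient[OF E valuated_matroidD(2)[OF \<mu>]]
  have self: "incidence_pluecker E r \<mu> r \<mu>"
    using inc_iff[OF valuated_matroidD(2)[OF \<mu>]] valuated_matroid_imp_quotient[OF \<mu>] by simp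
  have "trop_orthogonal E s \<nu> (valuated_cocircuit E \<mu> I)" if I: "I \<subseteq> E" "card I + 1 = r" for I
  proof (cases "valuated_cocircuit E \<mu> I = infty_vec E")
    case True
    \<comment> \<open>The all-infinite vector has no projective class, so the inclusion says nothing
      about it. It is orthogonal for trivial reasons.\<close>
    have "\<nu> (S - {i}) + infty_vec E i = \<infinity>" if "S \<in> nsets E (s + 1)" "i \<in> S" for S i
    proof -
      have "i \<in> E"
        using that by (auto simp: nsets_def)
      then show ?thesis
        by (simp add: infty_vec_def)
    qed
    then show ?thesis
      unfolding True trop_orthogonal_def by blast
  next
    case False
    have "\<mu> (insert j I) \<noteq> -\<infinity>" if "j \<in> E - I" for j
    proof (rule trop_vec_not_MInf[OF valuated_matroidD(2)[OF \<mu>]])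
      show "insert j I \<in> nsets E r"
        using I that finite_subset[OF I(1) E] by (auto simp: nsets_def)
    qed
    then have v: "valuated_cocircuit E \<mu> I \<in> trop_vec E - {infty_vec E}"
      using False by (auto simp: trop_vec_def valuated_cocircuit_def)
    have "trop_orthogonal E r \<mu> (valuated_cocircuit E \<mu> I)"
      using self I incidence_pluecker_iff_valuated_cocircuits[OF E] by blast
    then show ?thesis
      using proj_class_mem_proj_trop_linear_space_iff[OF \<mu> v]
        proj_class_mem_proj_trop_linear_space_iff[OF \<nu> v] sub by blast
  qed
  then have "incidence_pluecker E r \<mu> s \<nu>"
    using incidence_pluecker_iff_valuated_cocircuits[OF E] by blast
  then show ?thesis
    using inc_iff[OF valuated_matroidD(2)[OF \<nu>]] by blast
qed

section \<open>Change of representatives, and flag weights\<close>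

text \<open>Points of the flag Dressian provide only some representatives of the classes. Each entry
  of a relation contains one value of each vector, so changing representatives shifts all entries by
  the same constant.\<close>

lemma incidence_pluecker_shift:
  assumes E: "finite E" and inc: "incidence_pluecker E r p s q"
    and p: "\<And>I. I \<in> nsets E r \<Longrightarrow> p I = p' I + ereal c"
    and q: "\<And>J. J \<in> nsets E s \<Longrightarrow> q J = q' J + ereal d"
  shows "incidence_pluecker E r p' s q'"
  unfolding incidence_pluecker_iff[OF E]
proof (intro allI ballI impI)
  fix I' J' i assume I': "I' \<subseteq> E" "card I' + 1 = r" and J': "J' \<in> nsets E (s + 1)"
    and i: "i \<in> J' - I'" and fin: "p' (insert i I') + q' (J' - {i}) \<noteq> \<infinity>"
  have eq: "p (insert j I') + q (J' - {j}) = p' (insert j I') + q' (J' - {j}) + ereal (c + d)"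
    if "j \<in> J' - I'" for j
  proof -
    have "insert j I' \<in> nsets E r" "J' - {j} \<in> nsets E s"
      using I' J' that finite_subset[OF I'(1) E] by (auto simp: nsets_def)
    then have "p (insert j I') + q (J' - {j}) = (p' (insert j I') + ereal c) + (q' (J' - {j}) + ereal d)"
      by (simp add: p q)
    also have "\<dots> = p' (insert j I') + q' (J' - {j}) + (ereal c + ereal d)"
      by (simp only: ac_simps)
    finally show ?thesis
      by simp
  qed
  have "p (insert i I') + q (J' - {i}) \<noteq> \<infinity>"
    unfolding eq[OF i] ereal_add_eq_PInf by (rule fin)
  then obtain j where "j \<in> J' - I'" "j \<noteq> i"
    "p (insert j I') + q (J' - {j}) \<le> p (insert i I') + q (J' - {i})"
    using inc I' J' i unfolding incidence_pluecker_iff[OF E] by blast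
  then show "\<exists>j\<in>J' - I'. j \<noteq> i \<and> p' (insert j I') + q' (J' - {j}) \<le> p' (insert i I') + q' (J' - {i})"
    using eq i by (intro bexI[of _ j]) (simp_all add: ereal_add_le_cancel)
qed

text \<open>The weight is a sum of terms that each involve one coordinate of the tuple, so
  minimizing over the product means minimizing in each coordinate.\<close>

lemma flag_minimizers_eq_initial_bases:
  assumes val: "\<And>i. i \<in> {1..k} \<Longrightarrow> valuated_matroid E (r i) (\<mu> i)"
    and M: "\<And>i. i \<in> {1..k} \<Longrightarrow> M i = val_bases E (r i) (\<mu> i)"
  shows "flag_minimizers E k M \<mu> u = (\<Pi>\<^sub>E i\<in>{1..k}. initial_bases E (r i) (\<mu> i) u)"
proof -
  \<comment> \<open>All weights in play are finite, and real numbers allow cancelling the unchanged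
    summands.\<close>
  define h where "h i B = real_of_ereal (\<mu> i B) + sum u B" for i B
  have h: "\<mu> i B + ereal (sum u B) = ereal (h i B)" if i: "i \<in> {1..k}" and B: "B \<in> M i" for i B
  proof -
    obtain x where "\<mu> i B = ereal x"
      using val_bases_real[OF valuated_matroidD(2)[OF val[OF i]]] B M[OF i] by metis
    then show ?thesis
      by (simp add: h_def)
  qed
  have weight: "flag_weight E k \<mu> u B = ereal (\<Sum>i=1..k. h i (B i))" if B: "B \<in> Pi\<^sub>E {1..k} M" for B
  proof -
    have "\<mu> i (B i) + ereal (\<Sum>a\<in>E. u a * indicator (B i) a) = ereal (h i (B i))" if i: "i \<in> {1..k}" for i
    proof -
      have Bi: "B i \<in> M i"
        using B i by (rule PiE_mem)
      then have "B i \<subseteq> E"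
        using M[OF i] by (auto dest: val_basesD)
      then have "(\<Sum>a\<in>E. u a * indicator (B i) a) = sum u (B i)"
        using valuated_matroidD(1)[OF val[OF i]]
        by (simp add: indicator_def sum.If_cases Int_absorb1 if_distrib cong: if_cong)
      then show ?thesis
        using h[OF i Bi] by simp
    qed
    then show ?thesis
      by (simp add: flag_weight_def)
  qed
  have init: "initial_bases E (r i) (\<mu> i) u = {B\<in>M i. \<forall>B'\<in>M i. h i B \<le> h i B'}" if i: "i \<in> {1..k}" for i
    unfolding initial_bases_def M[OF i, symmetric] using h[OF i] by auto
  show ?thesis
  proof (intro equalityI subsetI)
    fix B assume "B \<in> flag_minimizers E k M \<mu> u"
    then have B: "B \<in> Pi\<^sub>E {1..k} M"
      and min: "\<And>B'. B' \<in> Pi\<^sub>E {1..k} M \<Longrightarrow> (\<Sum>i=1..k. h i (B i)) \<le> (\<Sum>i=1..k. h i (B' i))"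
      by (auto simp: flag_minimizers_def weight)
    have "h i (B i) \<le> h i B'" if i: "i \<in> {1..k}" and B': "B' \<in> M i" for i B'
    proof -
      \<comment> \<open>Changing one coordinate of a minimizing tuple isolates the comparison in
        that coordinate.\<close>
      have "B(i := B') \<in> Pi\<^sub>E {1..k} M"
        using B B' i by (auto simp: PiE_def extensional_def Pi_def)
      from min[OF this]
      have "(\<Sum>j=1..k. h j (B j)) \<le> (\<Sum>j=1..k. h j ((B(i := B')) j))" .
      moreover have "(\<Sum>j\<in>{1..k} - {i}. h j ((B(i := B')) j)) = (\<Sum>j\<in>{1..k} - {i}. h j (B j))"
        by (rule sum.cong) auto
      ultimately show ?thesis
        using sum.remove[OF _ i, of "\<lambda>j. h j (B j)"] sum.remove[OF _ i, of "\<lambda>j. h j ((B(i := B')) j)"]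
        by simp
    qed
    then show "B \<in> (\<Pi>\<^sub>E i\<in>{1..k}. initial_bases E (r i) (\<mu> i) u)"
      using B by (auto simp: init PiE_def Pi_def)
  next
    fix B assume B: "B \<in> (\<Pi>\<^sub>E i\<in>{1..k}. initial_bases E (r i) (\<mu> i) u)"
    have Bi: "B i \<in> M i" "\<And>B'. B' \<in> M i \<Longrightarrow> h i (B i) \<le> h i B'" if "i \<in> {1..k}" for i
      using PiE_mem[OF B that] that by (auto simp: init)
    have BM: "B \<in> Pi\<^sub>E {1..k} M"
      using B Bi(1) by (auto simp: PiE_def Pi_def)
    have "(\<Sum>i=1..k. h i (B i)) \<le> (\<Sum>i=1..k. h i (B' i))" if "B' \<in> Pi\<^sub>E {1..k} M" for B'
      by (intro sum_mono Bi(2) PiE_mem[OF that])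
    then show "B \<in> flag_minimizers E k M \<mu> u"
      using BM by (auto simp: flag_minimizers_def weight)
  qed
qed

section \<open>Equivalence of the four conditions\<close>

theorem theoremA:
  fixes n k :: nat
    and r :: "nat \<Rightarrow> nat"
    and \<mu> :: "nat \<Rightarrow> nat set \<Rightarrow> ereal"
    and M :: "nat \<Rightarrow> nat set set"
  assumes "\<forall>i\<in>{1..k}. valuated_matroid {1..n} (r i) (\<mu> i)"
    and "mono_on {1..k} r"
    and "\<forall>i\<in>{1..k}. M i = val_bases {1..n} (r i) (\<mu> i)"
    and "flag_matroid {1..n} k M"
  defines "a \<equiv> (\<lambda>i\<in>{1..k}. proj_class (nsets {1..n} (r i)) (\<mu> i)) \<in> flag_dressian_of {1..n} k r M"
    and "b \<equiv> valuated_flag_matroid {1..n} k r \<mu>"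
    and "c \<equiv> (\<forall>u :: nat \<Rightarrow> real. \<exists>N. flag_matroid {1..n} k N \<and>
           flag_minimizers {1..n} k M \<mu> u = Pi\<^sub>E {1..k} N)"
    and "d \<equiv> (\<forall>i\<in>{1..<k}. proj_trop_linear_space {1..n} (r i) (\<mu> i)
           \<subseteq> proj_trop_linear_space {1..n} (r (i + 1)) (\<mu> (i + 1)))"
  shows "(a \<longleftrightarrow> b) \<and> (b \<longleftrightarrow> c) \<and> (c \<longleftrightarrow> d)"
proof -
  let ?E = "{1..n}"
  let ?N = "\<lambda>u i. initial_bases ?E (r i) (\<mu> i) u"
  have val: "valuated_matroid ?E (r i) (\<mu> i)" if "i \<in> {1..k}" for i
    using assms(1) that by blast
  have M: "M i = val_bases ?E (r i) (\<mu> i)" if "i \<in> {1..k}" for i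
    using assms(3) that by blast
  note \<mu> = valuated_matroidD(2)[OF val]
  have inc_iff: "incidence_pluecker ?E (r i) (\<mu> i) (r j) (\<mu> j) \<longleftrightarrow> valuated_quotient ?E (r i) (\<mu> i) (r j) (\<mu> j)"
    if "i \<in> {1..k}" "j \<in> {1..k}" for i j
    by (rule incidence_pluecker_iff_valuated_quotient[OF _ \<mu>[OF that(1)] \<mu>[OF that(2)]]) simp
  have b_iff: "b \<longleftrightarrow> (\<forall>i\<in>{1..k}. \<forall>j\<in>{1..k}. i < j \<longrightarrow> valuated_quotient ?E (r i) (\<mu> i) (r j) (\<mu> j))"
    using assms(1,2) unfolding b_def valuated_flag_matroid_def by blast
  have vec: "\<mu> i \<in> trop_vec (nsets ?E (r i)) - {infty_vec (nsets ?E (r i))}" if i: "i \<in> {1..k}" for i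
  proof -
    obtain B where "B \<in> val_bases ?E (r i) (\<mu> i)"
      using valuated_matroidD(3)[OF val[OF i]] by blast
    then show ?thesis
      using \<mu>[OF i] by (auto simp: val_bases_def infty_vec_def)
  qed

  \<comment> \<open>From (b) to (a), the \<open>\<mu> i\<close> themselves serve as
    representatives.\<close>
  have "a" if b
  proof -
    let ?P = "\<lambda>i\<in>{1..k}. proj_class (nsets ?E (r i)) (\<mu> i)"
    have "?P \<in> (\<Pi>\<^sub>E i\<in>{1..k}. trop_proj (nsets ?E (r i)))"
      using vec by (auto simp: trop_proj_def proj_class_def intro!: quotientI)
    moreover have "\<forall>i\<in>{1..k}. \<mu> i \<in> ?P i"
      using proj_class_self[OF vec] by simp
    moreover have "\<forall>i\<in>{1..k}. grassmann_pluecker ?E (r i) (\<mu> i)"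
      using valuated_matroid_imp_grassmann_pluecker[OF val] by blast
    moreover have "\<forall>i\<in>{1..k}. \<forall>j\<in>{1..k}. i < j \<longrightarrow> incidence_pluecker ?E (r i) (\<mu> i) (r j) (\<mu> j)"
      using that inc_iff unfolding b_iff by blast
    ultimately have "?P \<in> flag_dressian ?E k r"
      unfolding flag_dressian_def by blast
    moreover have "?P i \<in> trop_stratum (nsets ?E (r i)) (M i)" if i: "i \<in> {1..k}" for i
      using i vec[OF i] unfolding M[OF i] trop_stratum_def val_bases_def by auto
    ultimately show a
      unfolding a_def flag_dressian_of_def by blast
  qed
  moreover have b if A: a
  proof -
    obtain p where P: "\<forall>i\<in>{1..k}. p i \<in> (\<lambda>i\<in>{1..k}. proj_class (nsets ?E (r i)) (\<mu> i)) i"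
      and inc: "\<And>i j. i \<in> {1..k} \<Longrightarrow> j \<in> {1..k} \<Longrightarrow> i < j \<Longrightarrow> incidence_pluecker ?E (r i) (p i) (r j) (p j)"
      using A unfolding a_def flag_dressian_of_def flag_dressian_def by blast
    have p: "p i \<in> proj_class (nsets ?E (r i)) (\<mu> i)" if "i \<in> {1..k}" for i
      using bspec[OF P that] that by simp
    have "valuated_quotient ?E (r i) (\<mu> i) (r j) (\<mu> j)" if ij: "i \<in> {1..k}" "j \<in> {1..k}" "i < j" for i j
    proof -
      obtain ci where ci: "\<And>I. I \<in> nsets ?E (r i) \<Longrightarrow> p i I = \<mu> i I + ereal ci"
        using mem_proj_classD[OF p[OF ij(1)]] by metis
      obtain cj where cj: "\<And>I. I \<in> nsets ?E (r j) \<Longrightarrow> p j I = \<mu> j I + ereal cj"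
        using mem_proj_classD[OF p[OF ij(2)]] by metis
      show ?thesis
        using incidence_pluecker_shift[OF _ inc[OF ij] ci cj] inc_iff[OF ij(1,2)] by simp
    qed
    then show b
      unfolding b_iff by blast
  qed
  moreover have min: "flag_minimizers ?E k M \<mu> u = Pi\<^sub>E {1..k} (?N u)" for u
    by (rule flag_minimizers_eq_initial_bases[OF val M])
  have c if b
    unfolding c_def
  proof (intro allI exI conjI)
    fix u
    show "flag_minimizers ?E k M \<mu> u = Pi\<^sub>E {1..k} (?N u)"
      by (rule min)
    show "flag_matroid ?E k (?N u)"
      unfolding flag_matroid_def
      using initial_bases_matroid[OF val] initial_bases_quotient[OF val val] that unfolding b_iff by blast
  qed
  moreover have d if c
  proof -
    have "matroid_quotient ?E (?N u i) (?N u j)" if ij: "i \<in> {1..k}" "j \<in> {1..k}" "i < j" for u i j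
    proof -
      obtain N where N: "flag_matroid ?E k N" "Pi\<^sub>E {1..k} (?N u) = Pi\<^sub>E {1..k} N"
        using \<open>c\<close> min unfolding c_def by metis
      \<comment> \<open>A product with nonempty factors determines its factors, so the flag matroid
        provided by (c) consists of the initial matroids.\<close>
      have ne: "?N u i \<noteq> {}" if "i \<in> {1..k}" for i
        using initial_bases_nonempty[OF valuated_matroidD(1,3)[OF val[OF that]]] .
      have neN: "N i \<noteq> {}" if "i \<in> {1..k}" for i
        using N(1) that by (auto simp: flag_matroid_def matroid_def)
      have "\<forall>i\<in>{1..k}. ?N u i = N i"
        using iffD1[OF PiE_eq_iff_not_empty N(2)] ne neN by simp
      moreover have "matroid_quotient ?E (N i) (N j)"
        using N(1) ij unfolding flag_matroid_def by blast
      ultimately show ?thesis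
        using ij by simp
    qed
    then show d
      unfolding d_def by (intro ballI proj_trop_linear_space_mono val) auto
  qed
  moreover have b if d
  proof -
    let ?L = "\<lambda>i. proj_trop_linear_space ?E (r i) (\<mu> i)"
    \<comment> \<open>Condition (d) compares neighbours only, whereas (b) concerns all
      pairs.\<close>
    have "?L i \<subseteq> ?L j" if "i \<le> j" "1 \<le> i" "j \<le> k" for i j
      using that
    proof (induction j rule: dec_induct)
      case (step j)
      then have "?L j \<subseteq> ?L (j + 1)"
        using \<open>d\<close> unfolding d_def by auto
      then show ?case
        using step by auto
    qed simp
    then show b
      unfolding b_iff using valuated_quotient_if_proj_trop_linear_space_mono[OF val val] by simp
  qed
  ultimately show ?thesis
    by blast
qed

end
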